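(* Let $\Omega=[0,1)$ with Lebesgue measure $\mathbb P$, let $p(\cdot):[0,1)\to(0,\infty)$ be measurable with $1<p_-\le p_+<\infty$, where $p_-=\operatorname{ess\,inf}p$, $p_+=\operatorname{ess\,sup}p$, and let $0<\alpha,s<\infty$. Assume that there is a constant $K\ge1$ such that $\mathbb P(A)^{p_-(A)-p_+(A)}\le K$ for every dyadic interval $A\subset[0,1)$. If $$\frac1{p_-}-\frac1{p_+}<\alpha+s,$$ then there is a constant $C$ (independent of $f$) such that $$\|V_{\alpha,s}f\|_{p(\cdot)}\le C\|f\|_{p(\cdot)}\qquad\text{for all } f\in L_{p(\cdot)}.$$
   Context: For measurable $A\subset[0,1)$, $p_-(A)=\operatorname{ess\,inf}_{x\in A}p(x)$ and $p_+(A)=\operatorname{ess\,sup}_{x\in A}p(x)$. $\|f\|_{p(\cdot)}=\inf\{\lambda>0:\int_0^1(|f(x)|/\lambda)^{p(x)}dx\le1\}$, and $L_{p(\cdot)}$ is the set of measurable functions on $[0,1)$ with $\|f\|_{p(\cdot)}<\infty$ (contained in $L_1$ here). Dyadic intervals are $[k2^{-n},(k+1)2^{-n})$, $n\in\mathbb N=\{0,1,2,\dots\}$, $0\le k<2^n$. $\dot+$ denotes dyadic addition on $[0,1)$: binary digits are added modulo 2 without carry (using the finite binary expansion for dyadic rationals); for sets, $A\dot+B=\{a\dot+b:a\in A,b\in B\}$ and $A\dot+b=A\dot+\{b\}$. For a dyadic interval $I$ of length $2^{-n}$ and $0\le j\le i\le n-1$ put $$I^{j,i}=I\dot+\big(2^{-j-1}\dot+[0,2^{-i})\big),$$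 which is a dyadic interval of length $2^{-i}$ (for $i>j$ one has $2^{-j-1}\dot+[0,2^{-i})=[2^{-j-1},2^{-j-1}\dot+2^{-i})$). For $f\in L_1[0,1)$, $$V_{\alpha,s}f(x)=\sup_{I\ni x}\ \sum_{j=0}^{n-1}\sum_{i=j}^{n-1}2^{(j-n)\alpha}2^{(j-i)s}\frac1{\mathbb P(I^{j,i})}\left|\int_{I^{j,i}}f\,d\mathbb P\right|,$$ where the supremum is over all dyadic intervals $I$ containing $x$ and $2^{-n}$ is the length of $I$. *)

theory Defs
  imports "HOL-Analysis.Analysis" "HOL-Probability.Essential_Supremum"
begin

abbreviation unit_measure :: "real measure" where
  "unit_measure \<equiv> lebesgue_on {0..<1}"

definition p_plus :: "(real \<Rightarrow> real) \<Rightarrow> real set \<Rightarrow> ereal" where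
  "p_plus p A = esssup (lebesgue_on A) (\<lambda>x. ereal (p x))"

text \<open>The library has no essential infimum; it is \<open>- ess sup (- p)\<close>.\<close>

definition p_minus :: "(real \<Rightarrow> real) \<Rightarrow> real set \<Rightarrow> ereal" where
  "p_minus p A = - esssup (lebesgue_on A) (\<lambda>x. ereal (- p x))"

text \<open>The norm is defined for functions with values in \<open>[0,\<infinity>]\<close>, because the
  maximal function may be infinite. Powers follow \<open>\<infinity>\<^sup>r = \<infinity>\<close> for \<open>r > 0\<close>; only positive
  exponents are used.\<close>

definition ennpowr :: "ennreal \<Rightarrow> real \<Rightarrow> ennreal" where
  "ennpowr a r = (if a = \<infinity> then \<infinity> else ennreal (enn2real a powr r))"

definition var_norm_nn :: "(real \<Rightarrow> real) \<Rightarrow> (real \<Rightarrow> ennreal) \<Rightarrow> ennreal" where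
  "var_norm_nn p g =
     Inf {ennreal t | t. 0 < t \<and> (\<integral>\<^sup>+ x. ennpowr (g x / ennreal t) (p x) \<partial>unit_measure) \<le> 1}"

definition var_norm :: "(real \<Rightarrow> real) \<Rightarrow> (real \<Rightarrow> real) \<Rightarrow> ennreal" where
  "var_norm p f = var_norm_nn p (\<lambda>x. ennreal \<bar>f x\<bar>)"

definition var_Lp :: "(real \<Rightarrow> real) \<Rightarrow> (real \<Rightarrow> real) set" where
  "var_Lp p = {f. f \<in> borel_measurable unit_measure \<and> var_norm p f < \<infinity>}"

definition dyadic_interval :: "nat \<Rightarrow> nat \<Rightarrow> real set" where
  "dyadic_interval n k = {real k / 2 ^ n ..< (real k + 1) / 2 ^ n}"

text \<open>For \<open>x \<in> [0,1)\<close> the floor picks the finite expansion of a dyadic rational.\<close>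

definition binary_digit :: "real \<Rightarrow> nat \<Rightarrow> int" where
  "binary_digit x k = \<lfloor>2 ^ Suc k * x\<rfloor> mod 2"

text \<open>The digitwise sum can have all digits \<open>1\<close> (for \<open>0.1010\<dots>\<close> and \<open>0.0101\<dots>\<close>), so its
  value can be \<open>1\<close>; \<open>frac\<close> identifies \<open>1\<close> with \<open>0\<close> to obtain an operation on \<open>[0,1)\<close>.\<close>

definition dyadic_add :: "real \<Rightarrow> real \<Rightarrow> real" where
  "dyadic_add x y =
     frac (\<Sum>k. real_of_int ((binary_digit x k + binary_digit y k) mod 2) / 2 ^ Suc k)"

definition dyadic_set_add :: "real set \<Rightarrow> real set \<Rightarrow> real set" where
  "dyadic_set_add A B = {dyadic_add a b | a b. a \<in> A \<and> b \<in> B}"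

text \<open>For \<open>I\<close> of length \<open>2\<^sup>-\<^sup>n\<close> and \<open>j \<le> i < n\<close> this is a dyadic interval of length \<open>2\<^sup>-\<^sup>i\<close>,
  up to a single extra point: a digitwise sum ending in \<open>111\<dots>\<close> has the right endpoint of
  that interval as its value. This null set affects neither measures nor integrals.\<close>

definition shifted_interval :: "real set \<Rightarrow> nat \<Rightarrow> nat \<Rightarrow> real set" where
  "shifted_interval I j i =
     dyadic_set_add I (dyadic_set_add {1 / 2 ^ Suc j} {0 ..< 1 / 2 ^ i})"

text \<open>A dyadic interval \<open>I\<close> determines \<open>n\<close> and \<open>k\<close>, so the supremum over \<open>I\<close> is taken over
  pairs \<open>(n, k)\<close>.\<close>

definition V_maximal :: "real \<Rightarrow> real \<Rightarrow> (real \<Rightarrow> real) \<Rightarrow> real \<Rightarrow> ennreal" where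
  "V_maximal \<alpha> s f x =
     (SUP (n, k) \<in> {(n, k). k < 2 ^ n \<and> x \<in> dyadic_interval n k}.
        ennreal (\<Sum>j = 0..<n. \<Sum>i = j..<n.
          2 powr ((real j - real n) * \<alpha>) * 2 powr ((real j - real i) * s) *
          (1 / measure unit_measure (shifted_interval (dyadic_interval n k) j i)) *
          \<bar>set_lebesgue_integral unit_measure (shifted_interval (dyadic_interval n k) j i) f\<bar>))"

end

theory Submission
  imports Defs
begin

text \<open>Write \<open>p\<^sub>-\<close>, \<open>p\<^sub>+\<close> for the essential bounds of \<open>p\<close>, and suppose that \<open>\<integral> |F|\<^sup>p \<le> 1\<close>; by
  homogeneity it is enough to bound the modular of \<open>V F\<close> by a constant. Put \<open>q = p / p\<^sub>-\<close>,
  \<open>h = |F|\<^sup>q + 1\<close> and \<open>\<gamma> = 1 / p\<^sub>- - 1 / p\<^sub>+\<close>.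

  Geometry. Up to a null set the interval \<open>I\<^sup>j\<^sup>,\<^sup>i\<close> is the dyadic interval \<open>J\<close> of length \<open>2\<^sup>-\<^sup>i\<close> whose
  index is that of the ancestor of \<open>I\<close> with the bit \<open>i - j - 1\<close> flipped (nothing is flipped for
  \<open>i = j\<close>). So \<open>J\<close> lies in the ancestor \<open>L\<close> of \<open>I\<close> of length \<open>2\<^sup>-\<^sup>j\<close>
  (\<open>shifted_interval_bounds\<close>, \<open>average_shifted_interval\<close>).

  Pointwise estimate. Let \<open>H\<close> be the average of \<open>h\<close> over \<open>J\<close>; then \<open>H \<le> 3 2\<^bsup>i/p\<^sub>-\<^esup>\<close>. For almost all
  \<open>x \<in> L\<close> and \<open>t \<in> J\<close> the hypothesis on the exponent gives \<open>2\<^bsup>j(p(x) - p(t))\<^esup> \<le> K\<close>, whence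
  \<open>H\<^bsup>1/q(t)\<^esup>\<close> is at most \<open>c = 3 K 2\<^bsup>(i-j)\<gamma>\<^esup> H\<^bsup>1/q(x)\<^esup>\<close>. Averaging the elementary inequality
  \<open>|F| \<le> c + c\<^bsup>1-q\<^esup> |F|\<^sup>q\<close> over \<open>J\<close> bounds the average of \<open>|F|\<close> by \<open>2 c\<close> (\<open>average_le\<close>).
  The weights in \<open>V\<close> absorb the factor \<open>2\<^bsup>(i-j)\<gamma>\<^esup>\<close> exactly because \<open>\<gamma> < \<alpha> + s\<close>: with
  \<open>\<epsilon> = min \<alpha> (\<alpha> + s - \<gamma>)\<close> and \<open>\<rho> = 2\<^bsup>-\<epsilon>/2\<^esup>\<close> a term is at most a constant times
  \<open>\<rho>\<^bsup>n-j\<^esup> \<rho>\<^bsup>i-j\<^esup> H\<^bsup>1/q(x)\<^esup>\<close>, and summation gives \<open>(V F)\<^sup>p \<le> C Z\<close>, where \<open>Z\<close> is the sum over \<open>d\<close> of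
  \<open>\<rho>\<^sup>d\<close> times the \<open>p\<^sub>-\<close>-th power of the supremum of \<open>H\<close> over the intervals with \<open>i - j = d\<close>
  (\<open>V_sum_le\<close>).

  Integration. For fixed \<open>d\<close> that supremum is a maximal function of the dyadic martingale \<open>H\<close>
  evaluated at shifted points. The shift increases the integral of its \<open>r\<close>-th power at most by the
  factor \<open>d + 1\<close> (\<open>mean_shifted_max\<close>), so the sum over \<open>d\<close> converges, and the unshifted one is
  controlled by Doob's inequality (\<open>doob_maximal\<close>). Since \<open>p\<^sub>- > 1\<close> and
  \<open>h\<^bsup>p\<^sub>-\<^esup>\<close> is bounded by a multiple of \<open>|F|\<^sup>p + 1\<close>, the integral of \<open>Z\<close> is bounded
  (\<open>nn_integral_control\<close>). Both maximal inequalities are proved for finite sums over the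
  indices of the dyadic intervals of one level.\<close>

section \<open>Averages over the dyadic intervals of one level\<close>

text \<open>Index of the level-\<open>i\<close> interval obtained from the one with index \<open>m\<close> by flipping the bit
  \<open>d - 1\<close>. For \<open>d = 0\<close> the quotient \<open>1 div 2\<close> vanishes, and the shift is the identity.\<close>

definition dyadic_shift :: "nat \<Rightarrow> nat \<Rightarrow> nat" where
  "dyadic_shift d m = Bit_Operations.xor m (2 ^ d div 2)"

text \<open>Mean value over \<open>[0,1)\<close> of the step function with value \<open>\<phi> m\<close> on the \<open>m\<close>-th dyadic
  interval of level \<open>i\<close>.\<close>

definition mean :: "nat \<Rightarrow> (nat \<Rightarrow> real) \<Rightarrow> real" where
  "mean i \<phi> = (\<Sum>m<2 ^ i. \<phi> m) / 2 ^ i"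

lemma sum_lessThan_double: "(\<Sum>m<2 * (n::nat). g m) = (\<Sum>m<n. g (2 * m) + g (2 * m + 1))"
  for g :: "nat \<Rightarrow> 'a :: comm_monoid_add"
  by (induction n) (auto simp: add.assoc)

lemma mean_Suc: "mean (Suc i) g = mean i (\<lambda>m. (g (2 * m) + g (2 * m + 1)) / 2)"
  by (simp add: mean_def sum_lessThan_double flip: sum_divide_distrib)

lemma mean_div: "mean (Suc i) (\<lambda>m. \<phi> (m div 2)) = mean i \<phi>"
  by (simp add: mean_Suc)

lemma mean_div_power: "mean (i + d) (\<lambda>m. \<phi> (m div 2 ^ d)) = mean i \<phi>"
proof (induction d arbitrary: \<phi>)
  case (Suc d)
  have "mean (i + Suc d) (\<lambda>m. \<phi> (m div 2 ^ Suc d)) = mean (Suc (i + d)) (\<lambda>m. (\<lambda>m. \<phi> (m div 2 ^ d)) (m div 2))"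
    by (simp add: div_mult2_eq)
  also have "\<dots> = mean i \<phi>" by (subst mean_div) (rule Suc)
  finally show ?case .
qed simp

lemma mean_mono: "(\<And>m. m < 2 ^ i \<Longrightarrow> f m \<le> g m) \<Longrightarrow> mean i f \<le> mean i g"
  by (auto simp: mean_def intro!: divide_right_mono sum_mono)

lemma mean_add: "mean i (\<lambda>m. f m + g m) = mean i f + mean i g"
  by (simp add: mean_def sum.distrib add_divide_distrib)

lemma mean_diff: "mean i (\<lambda>m. f m - g m) = mean i f - mean i g"
  by (simp add: mean_def sum_subtractf diff_divide_distrib)

lemma mean_cmult: "mean i (\<lambda>m. c * f m) = c * mean i f"
  by (simp add: mean_def sum_distrib_left)

lemma xor_less_power: "a < 2 ^ n \<Longrightarrow> b < 2 ^ n \<Longrightarrow> Bit_Operations.xor a b < (2::nat) ^ n"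
  by (metis take_bit_nat_eq_self_iff take_bit_xor)

lemma xor_div_power:
  fixes a b :: nat
  shows "Bit_Operations.xor a b div 2 ^ l = Bit_Operations.xor (a div 2 ^ l) (b div 2 ^ l)"
  by (metis drop_bit_eq_div drop_bit_xor)

lemma half_power_less: "(2::nat) ^ d div 2 < 2 ^ d"
  by simp

lemma dyadic_shift_less: "d \<le> i \<Longrightarrow> m < 2 ^ i \<Longrightarrow> dyadic_shift d m < 2 ^ i"
  unfolding dyadic_shift_def
  by (intro xor_less_power less_le_trans[OF half_power_less]) (auto intro: power_increasing)

lemma dyadic_shift_involution: "dyadic_shift d (dyadic_shift d m) = m"
  by (simp add: dyadic_shift_def xor.assoc)

lemma dyadic_shift_div: "dyadic_shift d m div 2 ^ d = m div 2 ^ d"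
  by (simp add: dyadic_shift_def xor_div_power half_power_less div_less)

lemma mean_dyadic_shift:
  assumes "d \<le> i"
  shows "mean i (\<lambda>m. \<phi> (dyadic_shift d m)) = mean i \<phi>"
proof -
  have "(\<Sum>m<2 ^ i. \<phi> (dyadic_shift d m)) = (\<Sum>m<2 ^ i. \<phi> m)"
    by (rule sum.reindex_bij_witness[of _ "dyadic_shift d" "dyadic_shift d"])
      (auto simp: dyadic_shift_involution dyadic_shift_less[OF assms])
  then show ?thesis by (simp add: mean_def)
qed

section \<open>The shifted dyadic maximal function\<close>

text \<open>For the level-\<open>N\<close> interval with index \<open>k\<close>, \<open>N = d + t\<close>: the maximum over \<open>d \<le> i \<le> N\<close> of
  \<open>\<phi> i\<close> at the shift of its level-\<open>i\<close> ancestor. Levels below \<open>d\<close> do not occur, since there the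
  flipped bit does not exist.\<close>

primrec shifted_max :: "nat \<Rightarrow> (nat \<Rightarrow> nat \<Rightarrow> real) \<Rightarrow> nat \<Rightarrow> nat \<Rightarrow> real" where
  "shifted_max d \<phi> 0 k = \<phi> d (dyadic_shift d k)"
| "shifted_max d \<phi> (Suc t) k = max (shifted_max d \<phi> t (k div 2)) (\<phi> (d + Suc t) (dyadic_shift d k))"

lemma shifted_max_ge:
  assumes "l \<le> t"
  shows "\<phi> (d + l) (dyadic_shift d (k div 2 ^ (t - l))) \<le> shifted_max d \<phi> t k"
  using assms
proof (induction t arbitrary: k)
  case (Suc t)
  show ?case
  proof (cases "l = Suc t")
    case False
    then have l: "l \<le> t" using Suc.prems by simp
    have "k div 2 ^ (Suc t - l) = k div 2 div 2 ^ (t - l)"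
      using l by (simp add: Suc_diff_le div_mult2_eq)
    then show ?thesis using Suc.IH[OF l, of "k div 2"] by (simp add: le_max_iff_disj)
  qed simp
qed simp

lemma increasing_along_ancestors:
  fixes \<phi> :: "nat \<Rightarrow> nat \<Rightarrow> real"
  assumes "\<And>i m. \<phi> i (m div 2) \<le> \<phi> (Suc i) m"
  shows "\<phi> i (m div 2 ^ d) \<le> \<phi> (i + d) m"
proof (induction d arbitrary: m)
  case (Suc d)
  have "\<phi> i (m div 2 ^ Suc d) = \<phi> i (m div 2 div 2 ^ d)" by (simp add: div_mult2_eq)
  also have "\<dots> \<le> \<phi> (i + d) (m div 2)" by (rule Suc)
  also have "\<dots> \<le> \<phi> (i + Suc d) m" using assms by simp
  finally show ?case .
qed simp

text \<open>Passing from level \<open>N = d + t\<close> to \<open>N + 1\<close> adds to the maximum at most the increase of \<open>\<phi>\<close>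
  from level \<open>N - d\<close> to level \<open>N + 1\<close> above the shifted interval: an interval and its shift have the
  same ancestor at level \<open>N - d\<close>, and the maximum is already at least \<open>\<phi>\<close> there. The means of these
  increments telescope up to \<open>d + 1\<close> terms.\<close>

lemma mean_shifted_max_sum:
  assumes inc: "\<And>i m. \<phi> i (m div 2) \<le> \<phi> (Suc i) m" and nonneg: "\<And>i m. 0 \<le> \<phi> i m"
  shows "mean (d + t) (shifted_max d \<phi> t) \<le> (\<Sum>l=t..d + t. mean l (\<phi> l))"
proof (induction t)
  case 0
  have "mean d (\<phi> d) \<le> (\<Sum>l=0..d. mean l (\<phi> l))"
    by (rule member_le_sum) (auto simp: mean_def nonneg intro!: sum_nonneg divide_nonneg_nonneg)
  moreover have "mean d (shifted_max d \<phi> 0) = mean d (\<phi> d)"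
    using mean_dyadic_shift[of d d "\<phi> d"] by (simp add: mean_def)
  ultimately show ?case unfolding add_0_right by linarith
next
  case (Suc t)
  let ?N = "d + t"
  have "shifted_max d \<phi> (Suc t) k \<le> shifted_max d \<phi> t (k div 2)
      + (\<phi> (Suc ?N) (dyadic_shift d k) - \<phi> t (k div 2 ^ Suc d))" for k
  proof -
    have "\<phi> t (k div 2 ^ Suc d) = \<phi> t (dyadic_shift d (k div 2) div 2 ^ d)"
      by (simp add: dyadic_shift_div div_mult2_eq)
    also have "\<dots> \<le> \<phi> (t + d) (dyadic_shift d (k div 2))"
      by (rule increasing_along_ancestors[of \<phi>, OF inc])
    also have "\<dots> \<le> shifted_max d \<phi> t (k div 2)"
      using shifted_max_ge[of t t \<phi> d "k div 2"] by (simp add: add.commute)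
    finally have 1: "\<phi> t (k div 2 ^ Suc d) \<le> shifted_max d \<phi> t (k div 2)" .
    have "\<phi> t (k div 2 ^ Suc d) = \<phi> t (dyadic_shift d k div 2 ^ d div 2)"
      by (simp add: dyadic_shift_div mult.commute flip: div_mult2_eq)
    also have "\<dots> = \<phi> t (dyadic_shift d k div 2 ^ Suc d)"
      by (simp add: mult.commute flip: div_mult2_eq)
    also have "\<dots> \<le> \<phi> (t + Suc d) (dyadic_shift d k)"
      by (rule increasing_along_ancestors[of \<phi>, OF inc])
    finally show ?thesis using 1 by (simp add: add.commute)
  qed
  then have "mean (Suc ?N) (shifted_max d \<phi> (Suc t)) \<le> mean (Suc ?N) (\<lambda>k. shifted_max d \<phi> t (k div 2)
      + (\<phi> (Suc ?N) (dyadic_shift d k) - \<phi> t (k div 2 ^ Suc d)))"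
    by (intro mean_mono)
  also have "\<dots> = mean ?N (shifted_max d \<phi> t) + (mean (Suc ?N) (\<phi> (Suc ?N)) - mean t (\<phi> t))"
    using mean_div_power[of t "Suc d" "\<phi> t"]
    by (simp only: mean_add mean_diff mean_div mean_dyadic_shift[of d "Suc ?N"] le_add1 le_SucI)
      (simp add: add.commute)
  also have "\<dots> \<le> (\<Sum>l=t..?N. mean l (\<phi> l)) + (mean (Suc ?N) (\<phi> (Suc ?N)) - mean t (\<phi> t))"
    using Suc.IH by simp
  also have "\<dots> = (\<Sum>l=Suc t..Suc ?N. mean l (\<phi> l))"
    by (simp add: sum.atLeast_Suc_atMost[of t ?N])
  finally show ?case by (simp only: add_Suc_right)
qed

lemma mean_shifted_max:
  assumes inc: "\<And>i m. \<phi> i (m div 2) \<le> \<phi> (Suc i) m" and nonneg: "\<And>i m. 0 \<le> \<phi> i m"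
  shows "mean (d + t) (shifted_max d \<phi> t) \<le> (real d + 1) * mean (d + t) (\<phi> (d + t))"
proof -
  have "mean l (\<phi> l) \<le> mean (Suc l) (\<phi> (Suc l))" for l
    using mean_mono[of "Suc l" "\<lambda>m. \<phi> l (m div 2)"] by (simp add: inc mean_div)
  then have "mean l (\<phi> l) \<le> mean (d + t) (\<phi> (d + t))" if "l \<le> d + t" for l
    using that by (rule lift_Suc_mono_le)
  then have "(\<Sum>l=t..d + t. mean l (\<phi> l)) \<le> of_nat (card {t..d + t}) * mean (d + t) (\<phi> (d + t))"
    by (intro sum_bounded_above) auto
  then show ?thesis using mean_shifted_max_sum[of \<phi> d t, OF inc nonneg] by (simp add: add.commute)
qed

section \<open>Doob's maximal inequality for dyadic martingales\<close>

text \<open>Maximum of \<open>H\<close> over the interval with index \<open>m\<close> at level \<open>i\<close> and all its ancestors.\<close>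

primrec running_max :: "(nat \<Rightarrow> nat \<Rightarrow> real) \<Rightarrow> nat \<Rightarrow> nat \<Rightarrow> real" where
  "running_max H 0 m = H 0 m"
| "running_max H (Suc i) m = max (running_max H i (m div 2)) (H (Suc i) m)"

lemma running_max_ge: "H i m \<le> running_max H i m"
  by (cases i) auto

text \<open>Young's inequality for \<open>a\<close> and \<open>b\<^bsup>r-1\<^esup>\<close>, in the form of a bound for one increment of the
  power of a running maximum.\<close>

lemma powr_increment_le:
  fixes a b r :: real
  assumes "1 < r" "0 \<le> a" "0 \<le> b"
  shows "max b a powr r - b powr r \<le> r / (r - 1) * (a * (max b a powr (r - 1) - b powr (r - 1)))"
proof (cases "a \<le> b")
  case False
  have "a * b powr (r - 1) \<le> a powr r / r + (b powr (r - 1)) powr (r / (r - 1)) / (r / (r - 1))"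
    using assms by (intro Youngs_inequality) (auto simp: field_simps)
  also have "(b powr (r - 1)) powr (r / (r - 1)) = b powr r"
    using assms by (simp add: powr_powr)
  finally have "r / (r - 1) * (a * b powr (r - 1)) \<le> r / (r - 1) * (a powr r / r + b powr r / (r / (r - 1)))"
    using assms by (intro mult_left_mono) auto
  also have "\<dots> = a powr r / (r - 1) + b powr r" using assms by (simp add: field_simps)
  finally have 1: "r / (r - 1) * (a * b powr (r - 1)) \<le> a powr r / (r - 1) + b powr r" .
  have "a * a powr (r - 1) = a powr r" using assms by (simp add: powr_mult_base)
  then have "r / (r - 1) * (a * (a powr (r - 1) - b powr (r - 1))) =
      r / (r - 1) * a powr r - r / (r - 1) * (a * b powr (r - 1))" by (simp add: algebra_simps)
  moreover have "r / (r - 1) * a powr r - a powr r / (r - 1) = a powr r"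
  proof -
    have "r / (r - 1) * a powr r - a powr r / (r - 1) = (r - 1) * a powr r / (r - 1)"
      by (simp add: left_diff_distrib diff_divide_distrib)
    then show ?thesis using assms by simp
  qed
  moreover have "max b a = a" using False by simp
  ultimately show ?thesis using 1 by linarith
qed (simp add: max_def)

text \<open>Indices are not restricted to \<open>m < 2 ^ i\<close>: averages over intervals outside \<open>[0,1)\<close> are \<open>0\<close>
  with respect to Lebesgue measure on \<open>[0,1)\<close>, so they are martingales in this sense.\<close>

context
  fixes H :: "nat \<Rightarrow> nat \<Rightarrow> real" and r :: real
  assumes martingale: "\<And>i m. H i m = (H (Suc i) (2 * m) + H (Suc i) (2 * m + 1)) / 2"
    and nonneg: "\<And>i m. 0 \<le> H i m" and r: "1 < r"
begin

lemma running_max_nonneg: "0 \<le> running_max H i m"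
  using running_max_ge[of H i m] nonneg[of i m] by simp

text \<open>Summation of the increments. The weights \<open>R\<^bsup>r-1\<^esup>\<close> of level \<open>i\<close> are constant on the
  intervals of that level, so by the martingale property \<open>H i\<close> may be replaced by \<open>H (Suc i)\<close>
  against them.\<close>

lemma mean_running_max_le:
  "mean i (\<lambda>m. running_max H i m powr r) \<le> r / (r - 1) * mean i (\<lambda>m. H i m * running_max H i m powr (r - 1))"
proof (induction i)
  case 0
  have "a powr r \<le> r / (r - 1) * (a * a powr (r - 1))" if "0 \<le> a" for a
    using powr_increment_le[OF r that, of 0] that by (simp add: max_def)
  then show ?case using nonneg by (simp add: mean_def)
next
  case (Suc i)
  let ?c = "r / (r - 1)"
  let ?R = "\<lambda>m. running_max H i (m div 2)" and ?S = "running_max H (Suc i)"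
  have "mean (Suc i) (\<lambda>m. ?S m powr r) \<le>
      mean (Suc i) (\<lambda>m. ?R m powr r + ?c * (H (Suc i) m * (?S m powr (r - 1) - ?R m powr (r - 1))))"
    using powr_increment_le[OF r nonneg running_max_nonneg]
    by (intro mean_mono) (simp add: algebra_simps)
  also have "\<dots> = mean i (\<lambda>m. running_max H i m powr r) + ?c * (mean (Suc i) (\<lambda>m. H (Suc i) m * ?S m powr (r - 1))
      - mean (Suc i) (\<lambda>m. H (Suc i) m * ?R m powr (r - 1)))"
    by (simp only: mean_add mean_cmult right_diff_distrib mean_diff mean_div[of i "\<lambda>m. running_max H i m powr r"])
  also have "mean (Suc i) (\<lambda>m. H (Suc i) m * ?R m powr (r - 1)) = mean i (\<lambda>m. H i m * running_max H i m powr (r - 1))"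
    by (simp add: mean_Suc martingale[of i] algebra_simps add_divide_distrib)
  finally show ?case using Suc.IH by (simp add: right_diff_distrib)
qed

lemma doob_maximal:
  "mean i (\<lambda>m. running_max H i m powr r) \<le> (2 * r / (r - 1)) powr r * mean i (\<lambda>m. H i m powr r)"
proof -
  define c where "c = 2 * (r / (r - 1))"
  have c: "0 < c" using r by (simp add: c_def)
  let ?R = "running_max H i"
  \<comment> \<open>\<open>H R\<^bsup>r-1\<^esup>\<close> is at most \<open>R\<^sup>r / c\<close> or \<open>c\<^bsup>r-1\<^esup> H\<^sup>r\<close>, according to which of \<open>H\<close> and \<open>R / c\<close> is
    larger; \<open>c\<close> is chosen such that the first summand contributes half of the left-hand side.\<close>
  have "H i m * ?R m powr (r - 1) \<le> ?R m powr r / c + c powr (r - 1) * H i m powr r" for m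
  proof (cases "H i m \<le> ?R m / c")
    case True
    then have "H i m * ?R m powr (r - 1) \<le> ?R m / c * ?R m powr (r - 1)"
      by (intro mult_right_mono) auto
    also have "\<dots> = ?R m powr r / c" using running_max_nonneg by (simp add: powr_mult_base)
    finally show ?thesis by (smt (verit) mult_nonneg_nonneg powr_ge_zero)
  next
    case False
    then have "?R m \<le> c * H i m" using c by (simp add: field_simps)
    then have "H i m * ?R m powr (r - 1) \<le> H i m * (c * H i m) powr (r - 1)"
      using r nonneg running_max_nonneg by (intro mult_left_mono powr_mono2) auto
    also have "\<dots> = c powr (r - 1) * (H i m * H i m powr (r - 1))"
      using c nonneg by (simp add: powr_mult)
    also have "H i m * H i m powr (r - 1) = H i m powr r" using nonneg by (simp add: powr_mult_base)
    finally show ?thesis using c by (smt (verit) divide_nonneg_pos powr_ge_zero)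
  qed
  then have "mean i (\<lambda>m. H i m * ?R m powr (r - 1)) \<le> mean i (\<lambda>m. (1 / c) * ?R m powr r + c powr (r - 1) * H i m powr r)"
    by (intro mean_mono) simp
  also have "\<dots> = mean i (\<lambda>m. ?R m powr r) / c + c powr (r - 1) * mean i (\<lambda>m. H i m powr r)"
    by (simp only: mean_add mean_cmult) simp
  finally have "c / 2 * mean i (\<lambda>m. H i m * ?R m powr (r - 1)) \<le>
      c / 2 * (mean i (\<lambda>m. ?R m powr r) / c + c powr (r - 1) * mean i (\<lambda>m. H i m powr r))"
    using c by (intro mult_left_mono) auto
  also have "\<dots> = mean i (\<lambda>m. ?R m powr r) / 2 + (c * c powr (r - 1)) * mean i (\<lambda>m. H i m powr r) / 2"
    using c by (simp add: field_simps)
  also have "c * c powr (r - 1) = c powr r" using c by (simp add: powr_mult_base)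
  finally have "c / 2 * mean i (\<lambda>m. H i m * ?R m powr (r - 1)) \<le>
      mean i (\<lambda>m. ?R m powr r) / 2 + c powr r * mean i (\<lambda>m. H i m powr r) / 2" .
  moreover have "c / 2 = r / (r - 1)"
    unfolding c_def by (rule nonzero_mult_div_cancel_left) simp
  then have "mean i (\<lambda>m. ?R m powr r) \<le> c / 2 * mean i (\<lambda>m. H i m * ?R m powr (r - 1))"
    by (simp only: mean_running_max_le)
  ultimately have "mean i (\<lambda>m. ?R m powr r) \<le> c powr r * mean i (\<lambda>m. H i m powr r)"
    by linarith
  then show ?thesis by (simp only: c_def times_divide_eq_right)
qed

lemma shifted_maximal:
  "mean (d + t) (shifted_max d (\<lambda>i m. running_max H i m powr r) t) \<le>
     (real d + 1) * ((2 * r / (r - 1)) powr r * mean (d + t) (\<lambda>m. H (d + t) m powr r))"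
proof -
  have "mean (d + t) (shifted_max d (\<lambda>i m. running_max H i m powr r) t) \<le>
     (real d + 1) * mean (d + t) (\<lambda>m. running_max H (d + t) m powr r)"
    using r running_max_nonneg by (intro mean_shifted_max) (auto intro!: powr_mono2)
  also have "\<dots> \<le> (real d + 1) * ((2 * r / (r - 1)) powr r * mean (d + t) (\<lambda>m. H (d + t) m powr r))"
    by (intro mult_left_mono doob_maximal) auto
  finally show ?thesis .
qed

end

section \<open>Dyadic addition and the shifted intervals\<close>

text \<open>Index of the dyadic interval of level \<open>n\<close> containing \<open>x \<ge> 0\<close>; for \<open>x < 1\<close> its bits are
  the first \<open>n\<close> binary digits of \<open>x\<close>.\<close>

definition dyadic_index :: "nat \<Rightarrow> real \<Rightarrow> nat" where
  "dyadic_index n x = nat \<lfloor>2 ^ n * x\<rfloor>"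

lemma mem_dyadic_interval_iff:
  assumes "0 \<le> x"
  shows "x \<in> dyadic_interval n k \<longleftrightarrow> dyadic_index n x = k"
proof -
  have "x \<in> dyadic_interval n k \<longleftrightarrow> real k \<le> 2 ^ n * x \<and> 2 ^ n * x < real k + 1"
    by (auto simp: dyadic_interval_def field_simps)
  also have "\<dots> \<longleftrightarrow> \<lfloor>2 ^ n * x\<rfloor> = int k"
    by (auto simp: floor_eq_iff)
  also have "\<dots> \<longleftrightarrow> dyadic_index n x = k"
    using assms by (auto simp: dyadic_index_def)
  finally show ?thesis .
qed

lemma dyadic_index_bounds:
  assumes "0 \<le> x"
  shows "real (dyadic_index n x) \<le> 2 ^ n * x" "2 ^ n * x < real (dyadic_index n x) + 1"
  using assms by (auto simp: dyadic_index_def)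

lemma dyadic_index_div:
  assumes "i \<le> n"
  shows "dyadic_index n x div 2 ^ (n - i) = dyadic_index i x"
proof -
  have "2 ^ i * x = 2 ^ n * x / real_of_int (2 ^ (n - i))"
    using assms by (simp add: field_simps flip: power_add)
  then have "\<lfloor>2 ^ i * x\<rfloor> = \<lfloor>2 ^ n * x\<rfloor> div 2 ^ (n - i)"
    by (metis floor_divide_real_eq_div zero_le_numeral zero_le_power)
  then show ?thesis
    by (simp add: dyadic_index_def nat_div_distrib' nat_power_eq)
qed

lemma dyadic_index_less: "0 \<le> x \<Longrightarrow> x < 1 \<Longrightarrow> dyadic_index n x < 2 ^ n"
proof -
  assume "0 \<le> x" "x < 1"
  then have "2 ^ n * x < 2 ^ n * 1" by (intro mult_strict_left_mono) auto
  then have "real (dyadic_index n x) < 2 ^ n"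
    using dyadic_index_bounds(1)[OF \<open>0 \<le> x\<close>, of n] by linarith
  then show ?thesis by (metis of_nat_less_numeral_power_cancel_iff)
qed

lemma dyadic_index_Suc_div: "dyadic_index (Suc n) x div 2 = dyadic_index n x"
  using dyadic_index_div[of n "Suc n" x] by simp

lemma binary_digit_eq:
  assumes "0 \<le> x"
  shows "binary_digit x k = int (dyadic_index (Suc k) x mod 2)"
  using assms by (simp add: binary_digit_def dyadic_index_def nat_mod_distrib zmod_int)

lemma xor_double_step:
  fixes a b :: nat
  shows "Bit_Operations.xor a b =
    2 * Bit_Operations.xor (a div 2) (b div 2) + (a mod 2 + b mod 2) mod 2"
proof -
  have "Bit_Operations.xor a b = (of_bool (odd a \<noteq> odd b) :: nat) + 2 * Bit_Operations.xor (a div 2) (b div 2)"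
    by (rule xor_rec)
  then show ?thesis by (simp add: mod2_eq_if)
qed

text \<open>The terms of the series defining the dyadic sum of \<open>a\<close> and \<open>b\<close>.\<close>

abbreviation xor_digit :: "real \<Rightarrow> real \<Rightarrow> nat \<Rightarrow> real" where
  "xor_digit a b k \<equiv> real_of_int ((binary_digit a k + binary_digit b k) mod 2) / 2 ^ Suc k"

lemma sum_xor_digit:
  assumes "a \<in> {0..<1}" "b \<in> {0..<1}"
  shows "(\<Sum>k<N. xor_digit a b k) = real (Bit_Operations.xor (dyadic_index N a) (dyadic_index N b)) / 2 ^ N"
proof (induction N)
  case 0
  have "dyadic_index 0 a = 0" "dyadic_index 0 b = 0"
    using assms by (auto simp: dyadic_index_def floor_eq_iff)
  then show ?case by simp
next
  case (Suc N)
  let ?x = "\<lambda>N. Bit_Operations.xor (dyadic_index N a) (dyadic_index N b)"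
  have d: "(binary_digit a N + binary_digit b N) mod 2 =
      int ((dyadic_index (Suc N) a mod 2 + dyadic_index (Suc N) b mod 2) mod 2)"
    using assms by (simp add: binary_digit_eq zmod_int)
  have x: "?x (Suc N) = 2 * ?x N + (dyadic_index (Suc N) a mod 2 + dyadic_index (Suc N) b mod 2) mod 2"
    by (subst xor_double_step) (simp add: dyadic_index_Suc_div)
  show ?case
    by (simp only: sum.lessThan_Suc Suc.IH d x) (simp add: field_simps)
qed

lemma xor_digit_bounds: "0 \<le> xor_digit a b k" "xor_digit a b k \<le> (1/2) ^ Suc k"
proof -
  have "(binary_digit a k + binary_digit b k) mod 2 \<le> 1" by presburger
  then have "real_of_int ((binary_digit a k + binary_digit b k) mod 2) \<le> 1" by linarith
  then show "xor_digit a b k \<le> (1/2) ^ Suc k"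
    by (simp add: divide_right_mono power_one_over)
qed auto

lemma summable_half_power: "summable (\<lambda>k. (1/2::real) ^ Suc k)"
  by (subst summable_Suc_iff) (rule summable_geometric, simp)

lemma summable_xor_digit: "summable (xor_digit a b)"
  by (rule summable_comparison_test'[OF summable_half_power, of 0]) 
    (metis xor_digit_bounds real_norm_def abs_of_nonneg)

lemma xor_digit_tail:
  "(\<Sum>k. xor_digit a b (k + N)) \<in> {0..1 / 2 ^ N}"
proof -
  have s: "summable (\<lambda>k. xor_digit a b (k + N))"
    by (subst summable_iff_shift) (rule summable_xor_digit)
  have g: "(\<lambda>k. (1/2::real) ^ Suc (k + N)) sums (1 / 2 ^ N)"
  proof -
    have "(\<lambda>k. (1/2) ^ Suc N * (1/2::real) ^ k) sums ((1/2) ^ Suc N * (1 / (1 - 1/2)))"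
      by (intro sums_mult geometric_sums) simp
    then show ?thesis by (simp add: power_add power_one_over mult_ac)
  qed
  have "(\<Sum>k. xor_digit a b (k + N)) \<le> (\<Sum>k. (1/2::real) ^ Suc (k + N))"
    by (rule suminf_le[OF xor_digit_bounds(2) s sums_summable[OF g]])
  then show ?thesis
    using suminf_nonneg[OF s xor_digit_bounds(1)] g by (simp add: sums_iff)
qed

lemma dyadic_add_split:
  assumes "a \<in> {0..<1}" "b \<in> {0..<1}"
  shows "dyadic_add a b = frac (real (Bit_Operations.xor (dyadic_index N a) (dyadic_index N b)) / 2 ^ N
           + (\<Sum>k. xor_digit a b (k + N)))"
  unfolding dyadic_add_def
  by (subst suminf_split_initial_segment[OF summable_xor_digit, of _ _ N])
    (simp only: sum_xor_digit[OF assms] add.commute)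

lemma binary_digit_zero: "binary_digit 0 k = 0"
  by (simp add: binary_digit_def)

lemma suminf_binary_digit:
  assumes "x \<in> {0..<1}"
  shows "(\<Sum>k. xor_digit 0 x k) = x"
proof -
  have "(\<lambda>N. \<Sum>k<N. xor_digit 0 x k) \<longlonglongrightarrow> x"
  proof (rule tendsto_sandwich[of "\<lambda>N. x - (1/2) ^ N" _ _ "\<lambda>_. x"])
    have e: "(\<Sum>k<N. xor_digit 0 x k) = real (dyadic_index N x) / 2 ^ N" for N
      using sum_xor_digit[of 0 x N] assms by (simp add: dyadic_index_def)
    have l: "x - (1/2) ^ N \<le> real (dyadic_index N x) / 2 ^ N" for N
    proof -
      have "x < (real (dyadic_index N x) + 1) / 2 ^ N"
        using dyadic_index_bounds(2)[of x N] assms by (simp add: pos_less_divide_eq mult.commute)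
      then show ?thesis by (simp add: add_divide_distrib power_one_over)
    qed
    have u: "real (dyadic_index N x) / 2 ^ N \<le> x" for N
      using dyadic_index_bounds(1)[of x N] assms by (simp add: pos_divide_le_eq mult.commute)
    show "\<forall>\<^sub>F N in sequentially. x - (1/2) ^ N \<le> (\<Sum>k<N. xor_digit 0 x k)"
      unfolding e by (intro always_eventually allI l)
    show "\<forall>\<^sub>F N in sequentially. (\<Sum>k<N. xor_digit 0 x k) \<le> x"
      unfolding e by (intro always_eventually allI u)
    have "(\<lambda>N. x - (1/2) ^ N) \<longlonglongrightarrow> x - 0"
      by (intro tendsto_intros LIMSEQ_power_zero) simp
    then show "(\<lambda>N. x - (1/2) ^ N) \<longlonglongrightarrow> x" by simp
  qed simp
  then have "xor_digit 0 x sums x" by (simp add: sums_def)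
  then show ?thesis by (simp add: sums_iff)
qed

text \<open>A summand with only \<open>n\<close> binary digits changes the first \<open>n\<close> digits and leaves the rest
  of \<open>x\<close> as it is. In particular the digits of the sum do not end in \<open>111\<dots>\<close>, and no exceptional
  points occur.\<close>

lemma dyadic_add_rational:
  assumes "x \<in> {0..<1}" "k < 2 ^ n"
  shows "dyadic_add (real k / 2 ^ n) x =
    real (Bit_Operations.xor k (dyadic_index n x)) / 2 ^ n + (x - real (dyadic_index n x) / 2 ^ n)"
    (is "_ = ?r")
    and "dyadic_add (real k / 2 ^ n) x \<in> {0..<1}"
    and "dyadic_index n (dyadic_add (real k / 2 ^ n) x) = Bit_Operations.xor k (dyadic_index n x)"
proof -
  let ?a = "real k / 2 ^ n"
  have k: "real k < 2 ^ n" using assms(2) by (metis of_nat_less_numeral_power_cancel_iff)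
  have a: "?a \<in> {0..<1}" using k by simp
  have ia: "dyadic_index n ?a = k" by (simp add: dyadic_index_def)
  have dig: "binary_digit ?a (l + n) = 0" for l
  proof -
    have "2 ^ Suc (l + n) * ?a = real_of_int (2 * (2 ^ l * int k))" by (simp add: power_add)
    then have "\<lfloor>2 ^ Suc (l + n) * ?a\<rfloor> = 2 * (2 ^ l * int k)" by (metis floor_of_int)
    then show ?thesis by (simp add: binary_digit_def)
  qed
  have "xor_digit ?a x (l + n) = xor_digit 0 x (l + n)" for l
    by (simp only: dig binary_digit_zero)
  moreover have "(\<Sum>l. xor_digit 0 x (l + n)) = x - real (dyadic_index n x) / 2 ^ n"
    using suminf_split_initial_segment[OF summable_xor_digit, of 0 x n] suminf_binary_digit[OF assms(1)]
      sum_xor_digit[of 0 x n] assms(1) by (simp add: dyadic_index_def)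
  ultimately have eq: "dyadic_add ?a x = frac ?r"
    using dyadic_add_split[OF a assms(1), of n] by (simp add: ia)
  have x0: "0 \<le> x" using assms by simp
  have lt: "Bit_Operations.xor k (dyadic_index n x) < 2 ^ n"
    using assms by (intro xor_less_power dyadic_index_less) auto
  then have lt': "real (Bit_Operations.xor k (dyadic_index n x)) + 1 \<le> 2 ^ n"
    by (metis Suc_leI of_nat_Suc of_nat_le_iff of_nat_numeral of_nat_power add.commute)
  define u where "u = x - real (dyadic_index n x) / 2 ^ n"
  have "real (dyadic_index n x) / 2 ^ n \<le> x" "x < (real (dyadic_index n x) + 1) / 2 ^ n"
    using dyadic_index_bounds[OF x0, of n] by (simp_all add: pos_divide_le_eq pos_less_divide_eq mult.commute)
  then have u: "0 \<le> u" "u < 1 / 2 ^ n" by (auto simp: u_def add_divide_distrib)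
  have "(real (Bit_Operations.xor k (dyadic_index n x)) + 1) / 2 ^ n \<le> 1" using lt' by simp
  then have r: "0 \<le> ?r" "?r < 1" using u by (auto simp: add_divide_distrib u_def[symmetric])
  then have eq': "dyadic_add ?a x = ?r" using eq by (simp add: frac_eq)
  then show "dyadic_add ?a x = ?r" "dyadic_add ?a x \<in> {0..<1}" using r by auto
  show "dyadic_index n (dyadic_add ?a x) = Bit_Operations.xor k (dyadic_index n x)"
    unfolding eq' u_def[symmetric] by (subst mem_dyadic_interval_iff[symmetric, OF r(1)[folded u_def]])
     (use u in \<open>auto simp: dyadic_interval_def add_divide_distrib\<close>)
qed

lemma dyadic_add_rational_involution:
  assumes "x \<in> {0..<1}" "k < 2 ^ n"
  shows "dyadic_add (real k / 2 ^ n) (dyadic_add (real k / 2 ^ n) x) = x"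
proof -
  let ?y = "dyadic_add (real k / 2 ^ n) x"
  have "Bit_Operations.xor k (Bit_Operations.xor k (dyadic_index n x)) = dyadic_index n x"
    by (simp flip: xor.assoc)
  then have "dyadic_add (real k / 2 ^ n) ?y =
     real (dyadic_index n x) / 2 ^ n + (?y - real (Bit_Operations.xor k (dyadic_index n x)) / 2 ^ n)"
    using dyadic_add_rational(1)[OF dyadic_add_rational(2)[OF assms] assms(2)]
    by (simp add: dyadic_add_rational(3)[OF assms])
  also have "\<dots> = x" by (simp add: dyadic_add_rational(1)[OF assms])
  finally show ?thesis .
qed

lemma dyadic_interval_subset_unit: "k < 2 ^ n \<Longrightarrow> dyadic_interval n k \<subseteq> {0..<1}"
proof -
  assume "k < 2 ^ n"
  then have "real k + 1 \<le> 2 ^ n"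
    by (metis Suc_leI of_nat_Suc of_nat_le_iff of_nat_numeral of_nat_power add.commute)
  then show ?thesis by (auto simp: dyadic_interval_def field_simps intro: order_trans[rotated])
qed

lemma dyadic_add_image_interval:
  assumes "k < 2 ^ n" "i \<le> n" "l < 2 ^ i"
  shows "dyadic_add (real k / 2 ^ n) ` dyadic_interval i l =
    dyadic_interval i (Bit_Operations.xor (k div 2 ^ (n - i)) l)"
proof -
  let ?a = "real k / 2 ^ n"
  have sub: "dyadic_add ?a x \<in> dyadic_interval i (Bit_Operations.xor (k div 2 ^ (n - i)) l)"
    if "x \<in> dyadic_interval i l" "l < 2 ^ i" for x l
  proof -
    have x: "x \<in> {0..<1}" using that dyadic_interval_subset_unit by blast
    have y: "dyadic_add ?a x \<in> {0..<1}" by (rule dyadic_add_rational(2)[OF x assms(1)])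
    have "dyadic_index i (dyadic_add ?a x) = Bit_Operations.xor (k div 2 ^ (n - i)) (dyadic_index i x)"
      by (simp only: dyadic_index_div[OF assms(2), symmetric] dyadic_add_rational(3)[OF x assms(1)]
          xor_div_power)
    moreover have "dyadic_index i x = l"
      using that x by (simp add: mem_dyadic_interval_iff)
    ultimately show ?thesis using y by (simp add: mem_dyadic_interval_iff)
  qed
  show ?thesis
  proof (intro equalityI subsetI)
    fix y assume "y \<in> dyadic_add ?a ` dyadic_interval i l"
    then show "y \<in> dyadic_interval i (Bit_Operations.xor (k div 2 ^ (n - i)) l)"
      using sub assms(3) by blast
  next
    let ?l = "Bit_Operations.xor (k div 2 ^ (n - i)) l"
    fix y assume y: "y \<in> dyadic_interval i ?l"
    have "k div 2 ^ (n - i) < 2 ^ i"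
      using assms(1,2) by (metis div_less_iff_less_mult le_add_diff_inverse power_add zero_less_numeral zero_less_power)
    then have l: "?l < 2 ^ i" using assms(3) by (rule xor_less_power)
    have "Bit_Operations.xor (k div 2 ^ (n - i)) ?l = l"
      by (simp flip: xor.assoc)
    then have "dyadic_add ?a y \<in> dyadic_interval i l" using sub[OF y l] by simp
    moreover have "y \<in> {0..<1}" using y l dyadic_interval_subset_unit by blast
    ultimately show "y \<in> dyadic_add ?a ` dyadic_interval i l"
      using dyadic_add_rational_involution[OF _ assms(1), of y] by (metis image_eqI)
  qed
qed

lemma half_power_diff_less: "j \<le> i \<Longrightarrow> 2 ^ (i - j) div 2 < (2::nat) ^ i"
proof -
  assume "j \<le> i"
  have "(2::nat) ^ (i - j) div 2 < 2 ^ (i - j)" by simp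
  also have "\<dots> \<le> 2 ^ i" by simp
  finally show ?thesis .
qed

text \<open>\<open>2\<^bsup>-j-1\<^esup>\<close> is written with \<open>i + 1\<close> binary digits, which covers the case \<open>i = j\<close> too.\<close>

lemma dyadic_add_half_unit:
  assumes "j \<le> i"
  shows "dyadic_set_add {1 / 2 ^ Suc j} {0..<1 / 2 ^ i} = dyadic_interval i (2 ^ (i - j) div 2)"
proof -
  have t: "1 / 2 ^ Suc j = real (2 ^ (i - j)) / 2 ^ Suc i"
  proof -
    have "(2::real) ^ Suc i = 2 ^ (i - j) * 2 ^ Suc j" using assms by (simp flip: power_add)
    then show ?thesis by simp
  qed
  have u: "{0..<1 / 2 ^ i} = dyadic_interval i 0" by (simp add: dyadic_interval_def)
  have "dyadic_set_add {1 / 2 ^ Suc j} {0..<1 / 2 ^ i} =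
      dyadic_add (real (2 ^ (i - j)) / 2 ^ Suc i) ` dyadic_interval i 0"
    unfolding t u by (auto simp: dyadic_set_add_def)
  also have "\<dots> = dyadic_interval i (2 ^ (i - j) div 2)"
  proof -
    have "(2::nat) ^ (i - j) < 2 ^ Suc i" by (intro power_strict_increasing) auto
    then show ?thesis using dyadic_add_image_interval[of "2 ^ (i - j)" "Suc i" i 0] by simp
  qed
  finally show ?thesis .
qed

text \<open>For the first inclusion it suffices to add the left endpoint of the interval, which has
  finitely many digits. The two extra points in the second inclusion come from digit
  sums ending in \<open>111\<dots>\<close>: such a sum has the right endpoint as its value, or \<open>0\<close> if that endpoint
  is \<open>1\<close>.\<close>

lemma shifted_interval_bounds:
  fixes n k i j :: nat
  assumes "k < 2 ^ n" "j \<le> i" "i < n"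
  defines "m \<equiv> dyadic_shift (i - j) (k div 2 ^ (n - i))"
  shows "m < 2 ^ i"
    and "dyadic_interval i m \<subseteq> shifted_interval (dyadic_interval n k) j i"
    and "shifted_interval (dyadic_interval n k) j i \<subseteq> insert 0 (insert ((real m + 1) / 2 ^ i) (dyadic_interval i m))"
proof -
  let ?e = "2 ^ (i - j) div 2 :: nat"
  let ?T = "dyadic_interval i ?e"
  have e: "?e < 2 ^ i" by (rule half_power_diff_less[OF assms(2)])
  have kd: "k div 2 ^ (n - i) < 2 ^ i"
    using assms(1,3) by (metis div_less_iff_less_mult le_add_diff_inverse less_imp_le power_add zero_less_numeral zero_less_power)
  have m: "m = Bit_Operations.xor (k div 2 ^ (n - i)) ?e" by (simp add: m_def dyadic_shift_def)
  show m_less: "m < 2 ^ i" unfolding m by (rule xor_less_power[OF kd e])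
  have S: "shifted_interval (dyadic_interval n k) j i = dyadic_set_add (dyadic_interval n k) ?T"
    unfolding shifted_interval_def by (simp only: dyadic_add_half_unit[OF assms(2)])
  have "real k / 2 ^ n \<in> dyadic_interval n k" by (simp add: dyadic_interval_def divide_strict_right_mono)
  then have "dyadic_add (real k / 2 ^ n) ` ?T \<subseteq> dyadic_set_add (dyadic_interval n k) ?T"
    by (auto simp: dyadic_set_add_def)
  then show "dyadic_interval i m \<subseteq> shifted_interval (dyadic_interval n k) j i"
    using dyadic_add_image_interval[OF assms(1) _ e] assms(3) by (simp add: S m)
  show "shifted_interval (dyadic_interval n k) j i \<subseteq> insert 0 (insert ((real m + 1) / 2 ^ i) (dyadic_interval i m))"
  proof
    fix z assume "z \<in> shifted_interval (dyadic_interval n k) j i"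
    then obtain a b where ab: "a \<in> dyadic_interval n k" "b \<in> ?T" and z: "z = dyadic_add a b"
      by (auto simp: S dyadic_set_add_def)
    have a1: "a \<in> {0..<1}" using ab(1) dyadic_interval_subset_unit[OF assms(1)] by blast
    have b1: "b \<in> {0..<1}" using ab(2) dyadic_interval_subset_unit[OF e] by blast
    have ia: "dyadic_index i a = k div 2 ^ (n - i)"
      using ab(1) a1 assms(3) dyadic_index_div[of i n a] by (simp add: mem_dyadic_interval_iff)
    have ib: "dyadic_index i b = ?e" using ab(2) b1 by (simp add: mem_dyadic_interval_iff)
    define r where "r = (\<Sum>k. xor_digit a b (k + i))"
    have r: "r \<in> {0..1 / 2 ^ i}" unfolding r_def by (rule xor_digit_tail)
    have z': "z = frac (real m / 2 ^ i + r)"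
      unfolding z r_def m using dyadic_add_split[OF a1 b1, of i] by (simp only: ia ib)
    have m1: "real m + 1 \<le> 2 ^ i"
      using m_less by (metis Suc_leI of_nat_Suc of_nat_le_iff of_nat_numeral of_nat_power add.commute)
    show "z \<in> insert 0 (insert ((real m + 1) / 2 ^ i) (dyadic_interval i m))"
    proof (cases "r < 1 / 2 ^ i")
      case True
      have "real m / 2 ^ i + r < (real m + 1) / 2 ^ i" using True by (simp add: add_divide_distrib)
      also have "\<dots> \<le> 1" using m1 by simp
      finally have "z = real m / 2 ^ i + r" using z' r by (simp add: frac_eq)
      then show ?thesis using True r by (simp add: dyadic_interval_def add_divide_distrib)
    next
      case False
      then have "r = 1 / 2 ^ i" using r by auto
      then have z2: "z = frac ((real m + 1) / 2 ^ i)" using z' by (simp add: add_divide_distrib)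
      show ?thesis
      proof (cases "real m + 1 = 2 ^ i")
        case True
        then show ?thesis using z2 by simp
      next
        case False
        then have "(real m + 1) / 2 ^ i < 1" using m1 by simp
        then show ?thesis using z2 by (simp add: frac_eq)
      qed
    qed
  qed
qed

section \<open>Averages of integrable functions\<close>

lemma measure_dyadic_interval:
  assumes "m < 2 ^ i"
  shows "measure unit_measure (dyadic_interval i m) = 1 / 2 ^ i"
    "dyadic_interval i m \<in> sets unit_measure"
    "emeasure unit_measure (dyadic_interval i m) = ennreal (1 / 2 ^ i)"
proof -
  have sub: "dyadic_interval i m \<subseteq> {0..<1}" by (rule dyadic_interval_subset_unit[OF assms])
  have e: "emeasure lebesgue (dyadic_interval i m) = ennreal (1 / 2 ^ i)"
    unfolding dyadic_interval_def
    by (subst emeasure_completion) (auto simp: divide_right_mono add_divide_distrib)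
  show "dyadic_interval i m \<in> sets unit_measure"
    using sub by (simp add: sets_restrict_space_iff) (simp add: dyadic_interval_def)
  show em: "emeasure unit_measure (dyadic_interval i m) = ennreal (1 / 2 ^ i)"
    using e sub by (simp add: emeasure_restrict_space)
  show "measure unit_measure (dyadic_interval i m) = 1 / 2 ^ i"
    using em by (simp add: measure_def)
qed

lemma null_sets_finite_unit:
  assumes "finite (X :: real set)"
  shows "AE x in unit_measure. x \<notin> X"
proof -
  have "AE x in lebesgue. x \<notin> X"
    using assms by (intro AE_not_in negligible_iff_null_sets[THEN iffD1] negligible_finite)
  then have "AE x in lebesgue. x \<in> {0..<1} \<longrightarrow> x \<notin> X" by eventually_elim simp
  then show ?thesis by (simp add: AE_restrict_space_iff)
qed

lemma average_shifted_interval: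
  fixes n k i j :: nat and f :: "real \<Rightarrow> real"
  assumes "k < 2 ^ n" "j \<le> i" "i < n" "f \<in> borel_measurable unit_measure"
  defines "m \<equiv> dyadic_shift (i - j) (k div 2 ^ (n - i))"
  shows "measure unit_measure (shifted_interval (dyadic_interval n k) j i) = 1 / 2 ^ i"
    and "set_lebesgue_integral unit_measure (shifted_interval (dyadic_interval n k) j i) f =
       set_lebesgue_integral unit_measure (dyadic_interval i m) f"
proof -
  let ?S = "shifted_interval (dyadic_interval n k) j i" and ?D = "dyadic_interval i m"
  let ?X = "{0, (real m + 1) / 2 ^ i}"
  note b = shifted_interval_bounds[OF assms(1-3), folded m_def]
  have D: "?D \<in> sets unit_measure" by (rule measure_dyadic_interval(2)[OF b(1)])
  have DS: "?S = ?D \<union> (?S \<inter> ?X)" using b(2,3) by auto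
  have XX: "?S \<subseteq> {0..<1}"
  proof -
    have "dyadic_add a b \<in> {0..<1}" for a b by (simp add: dyadic_add_def frac_lt_1)
    then show ?thesis unfolding shifted_interval_def dyadic_set_add_def by blast
  qed
  have "?S \<inter> ?X \<in> sets unit_measure"
    using XX by (subst sets_restrict_space_iff) (auto intro!: sets_completionI_sets borel_closed finite_imp_closed)
  then have S: "?S \<in> sets unit_measure" using D DS by (metis sets.Un)
  have ae: "AE x in unit_measure. x \<in> ?S \<longleftrightarrow> x \<in> ?D"
    using null_sets_finite_unit[of ?X] by (rule AE_mp) (use DS in auto)
  show "measure unit_measure ?S = 1 / 2 ^ i"
    using measure_eq_AE[OF ae S D] measure_dyadic_interval(1)[OF b(1)] by simp
  show "set_lebesgue_integral unit_measure ?S f = set_lebesgue_integral unit_measure ?D f"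
    unfolding set_lebesgue_integral_def
  proof (rule integral_cong_AE)
    show "AE x in unit_measure. indicat_real ?S x *\<^sub>R f x = indicat_real ?D x *\<^sub>R f x"
      using ae by (rule AE_mp) (auto simp: indicator_def)
  qed (use S D assms(4) in \<open>auto intro!: borel_measurable_indicator borel_measurable_scaleR\<close>)
qed

text \<open>Average of \<open>g\<close> over the interval with index \<open>m\<close> at level \<open>i\<close>. For \<open>m \<ge> 2 ^ i\<close> the interval
  does not meet \<open>[0,1)\<close>, and the value is \<open>0\<close>.\<close>

definition dyadic_average :: "(real \<Rightarrow> real) \<Rightarrow> nat \<Rightarrow> nat \<Rightarrow> real" where
  "dyadic_average g i m = 2 ^ i * (LINT x|unit_measure. indicat_real (dyadic_interval i m) x * g x)"

lemma dyadic_interval_measurable: "indicat_real (dyadic_interval i m) \<in> borel_measurable unit_measure"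
proof -
  have "dyadic_interval i m \<in> sets borel" by (simp add: dyadic_interval_def)
  then have "indicat_real (dyadic_interval i m) \<in> borel_measurable lborel" by simp
  then show ?thesis by (intro measurable_restrict_space1 measurable_completion)
qed

lemma integrable_dyadic_indicator:
  fixes g :: "real \<Rightarrow> real"
  assumes "integrable unit_measure g"
  shows "integrable unit_measure (\<lambda>x. indicat_real (dyadic_interval i m) x * g x)"
proof (rule Bochner_Integration.integrable_bound[OF assms])
  show "(\<lambda>x. indicat_real (dyadic_interval i m) x * g x) \<in> borel_measurable unit_measure"
    using assms by (intro borel_measurable_times dyadic_interval_measurable) auto
qed (auto simp: indicator_def)

lemma dyadic_interval_split_indicator:
  "indicat_real (dyadic_interval i m) x =
    indicat_real (dyadic_interval (Suc i) (2 * m)) x + indicat_real (dyadic_interval (Suc i) (2 * m + 1)) x"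
  by (auto simp: indicator_def dyadic_interval_def field_simps)

lemma dyadic_average_martingale:
  assumes "integrable unit_measure g"
  shows "dyadic_average g i m = (dyadic_average g (Suc i) (2 * m) + dyadic_average g (Suc i) (2 * m + 1)) / 2"
proof -
  have "(LINT x|unit_measure. indicat_real (dyadic_interval i m) x * g x) =
      (LINT x|unit_measure. indicat_real (dyadic_interval (Suc i) (2 * m)) x * g x) +
      (LINT x|unit_measure. indicat_real (dyadic_interval (Suc i) (2 * m + 1)) x * g x)"
    by (simp only: dyadic_interval_split_indicator[of i m] distrib_right
      Bochner_Integration.integral_add integrable_dyadic_indicator[OF assms])
  then show ?thesis by (simp add: dyadic_average_def algebra_simps)
qed

lemma dyadic_average_mono_AE:
  assumes "integrable unit_measure f" "integrable unit_measure g"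
    and "AE x in unit_measure. x \<in> dyadic_interval i m \<longrightarrow> f x \<le> g x"
  shows "dyadic_average f i m \<le> dyadic_average g i m"
  unfolding dyadic_average_def
proof (intro mult_left_mono integral_mono_AE integrable_dyadic_indicator assms)
  show "AE x in unit_measure. indicat_real (dyadic_interval i m) x * f x \<le> indicat_real (dyadic_interval i m) x * g x"
    using assms(3) by eventually_elim (auto simp: indicator_def)
qed auto

lemma dyadic_average_add:
  assumes "integrable unit_measure f" "integrable unit_measure g"
  shows "dyadic_average (\<lambda>x. f x + g x) i m = dyadic_average f i m + dyadic_average g i m"
  by (simp add: dyadic_average_def distrib_left integrable_dyadic_indicator assms)

lemma dyadic_average_cmult: "dyadic_average (\<lambda>x. c * g x) i m = c * dyadic_average g i m"
  by (simp add: dyadic_average_def mult.left_commute[of _ c])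

lemma integrable_unit_const: "integrable unit_measure (\<lambda>x. c :: real)"
  by (rule finite_measure.integrable_const, rule finite_measureI) (simp add: emeasure_restrict_space)

lemma dyadic_average_const:
  assumes "m < 2 ^ i"
  shows "dyadic_average (\<lambda>x. c) i m = c"
proof -
  have "dyadic_interval i m \<subseteq> space unit_measure" using dyadic_interval_subset_unit[OF assms] by simp
  then have "(LINT x|unit_measure. indicat_real (dyadic_interval i m) x) = 1 / 2 ^ i"
    using measure_dyadic_interval(1)[OF assms] by (simp add: Int_absorb2 del: space_restrict_space)
  then show ?thesis by (simp add: dyadic_average_def)
qed

lemma dyadic_average_nonneg: "(\<And>x. 0 \<le> g x) \<Longrightarrow> 0 \<le> dyadic_average g i m"
  unfolding dyadic_average_def by (intro mult_nonneg_nonneg integral_nonneg_AE) auto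

lemma dyadic_average_le_integral:
  assumes "integrable unit_measure g" "\<And>x. 0 \<le> g x"
  shows "dyadic_average g i m \<le> 2 ^ i * (LINT x|unit_measure. g x)"
  unfolding dyadic_average_def
  using assms by (intro mult_left_mono integral_mono_AE integrable_dyadic_indicator) (auto simp: indicator_def)

lemma abs_dyadic_average_le:
  "\<bar>dyadic_average g i m\<bar> \<le> dyadic_average (\<lambda>x. \<bar>g x\<bar>) i m"
  unfolding dyadic_average_def
  using integral_norm_bound[of unit_measure "\<lambda>x. indicat_real (dyadic_interval i m) x * g x"]
  by (simp add: abs_mult)

lemma mean_dyadic_average:
  assumes "integrable unit_measure g"
  shows "mean i (dyadic_average g i) = (LINT x|unit_measure. g x)"
proof (induction i)
  case 0
  have "(LINT x|unit_measure. indicat_real (dyadic_interval 0 0) x * g x) = (LINT x|unit_measure. g x)"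
    by (rule Bochner_Integration.integral_cong) (auto simp: dyadic_interval_def)
  then show ?case by (simp add: mean_def dyadic_average_def)
next
  case (Suc i)
  then show ?case by (simp only: mean_Suc dyadic_average_martingale[OF assms, of i, symmetric])
qed

text \<open>This bound replaces Jensen's inequality, also for exponents \<open>r\<close> that depend on the point:
  after averaging, a suitable \<open>c\<close> makes the second summand at most the first, at the cost of a factor \<open>2\<close>.\<close>

lemma le_add_powr:
  fixes c t r :: real
  assumes "0 < c" "0 \<le> t" "1 \<le> r"
  shows "t \<le> c + c powr (1 - r) * t powr r"
proof (cases "t \<le> c")
  case True
  moreover have "0 \<le> c powr (1 - r) * t powr r" by simp
  ultimately show ?thesis by linarith
next
  case False
  then have "1 \<le> t / c" using assms by simp
  then have "(t / c) powr 1 \<le> (t / c) powr r" using assms by (intro powr_mono) auto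
  then have "t \<le> c * (t / c) powr r" using assms False by (simp add: field_simps)
  also have "\<dots> = c powr (1 - r) * t powr r" using assms by (simp add: powr_divide powr_diff)
  finally show ?thesis using assms by simp
qed

lemma dyadic_average_powr_le:
  assumes "integrable unit_measure g" "integrable unit_measure (\<lambda>x. g x powr r)"
    and g: "\<And>x. 0 \<le> g x" and r: "1 \<le> r" and m: "m < 2 ^ i"
  shows "dyadic_average g i m powr r \<le> 2 powr r * dyadic_average (\<lambda>x. g x powr r) i m"
proof -
  let ?A = "dyadic_average (\<lambda>x. g x powr r) i m"
  have A: "0 \<le> ?A" by (rule dyadic_average_nonneg) simp
  have *: "dyadic_average g i m \<le> c + c powr (1 - r) * ?A" if "0 < c" for c
  proof -
    have "dyadic_average g i m \<le> dyadic_average (\<lambda>x. c + c powr (1 - r) * g x powr r) i m"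
      using assms le_add_powr[OF that g r]
      by (intro dyadic_average_mono_AE Bochner_Integration.integrable_add integrable_unit_const) auto
    also have "\<dots> = c + c powr (1 - r) * ?A"
      using assms by (subst dyadic_average_add) (auto simp: integrable_unit_const dyadic_average_const dyadic_average_cmult)
    finally show ?thesis .
  qed
  have nn: "0 \<le> dyadic_average g i m" using g by (rule dyadic_average_nonneg)
  show ?thesis
  proof (cases "?A = 0")
    case True
    have "dyadic_average g i m \<le> 0"
    proof (rule field_le_epsilon)
      fix e :: real assume "0 < e"
      then show "dyadic_average g i m \<le> 0 + e" using *[of e] True by simp
    qed
    then show ?thesis using nn A by simp
  next
    case False
    then have A: "0 < ?A" using A by simp
    define c where "c = ?A powr (1 / r)"
    have c: "0 < c" "c powr r = ?A" using A r by (simp_all add: c_def powr_powr)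
    have "c powr (1 - r) * ?A = c" using c A by (simp add: powr_diff)
    then have "dyadic_average g i m \<le> 2 * c" using *[OF c(1)] by simp
    then have "dyadic_average g i m powr r \<le> (2 * c) powr r" using nn r by (intro powr_mono2) auto
    then show ?thesis using c by (simp add: powr_mult)
  qed
qed

lemma nn_integral_dyadic_step:
  assumes "\<And>k. 0 \<le> \<phi> k"
  shows "(\<lambda>x. ennreal (\<phi> (dyadic_index n x))) \<in> borel_measurable unit_measure"
    and "(\<integral>\<^sup>+ x. ennreal (\<phi> (dyadic_index n x)) \<partial>unit_measure) = ennreal (mean n \<phi>)"
proof -
  let ?s = "\<lambda>x. \<Sum>k<2 ^ n. ennreal (\<phi> k) * indicator (dyadic_interval n k) x"
  have eq: "ennreal (\<phi> (dyadic_index n x)) = ?s x" if "x \<in> space unit_measure" for x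
  proof -
    have x: "0 \<le> x" "x < 1" using that by auto
    have "?s x = (\<Sum>k<2 ^ n. if k = dyadic_index n x then ennreal (\<phi> k) else 0)"
      using x by (intro sum.cong) (auto simp: indicator_def mem_dyadic_interval_iff)
    then show ?thesis using dyadic_index_less[OF x] by simp
  qed
  have D: "dyadic_interval n k \<in> sets unit_measure" if "k < 2 ^ n" for k
    by (rule measure_dyadic_interval(2)[OF that])
  have "?s \<in> borel_measurable unit_measure"
    using D by (intro borel_measurable_sum borel_measurable_times_ennreal borel_measurable_indicator) auto
  then show "(\<lambda>x. ennreal (\<phi> (dyadic_index n x))) \<in> borel_measurable unit_measure"
    using measurable_cong[of unit_measure _ ?s, OF eq] by blast
  have "(\<integral>\<^sup>+ x. ennreal (\<phi> (dyadic_index n x)) \<partial>unit_measure) = (\<integral>\<^sup>+ x. ?s x \<partial>unit_measure)"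
    using eq by (rule nn_integral_cong)
  also have "\<dots> = (\<Sum>k<2 ^ n. ennreal (\<phi> k) * ennreal (1 / 2 ^ n))"
    using D by (subst nn_integral_sum)
      (auto simp: nn_integral_cmult_indicator measure_dyadic_interval(3) intro!: sum.cong)
  also have "\<dots> = (\<Sum>k<2 ^ n. ennreal (\<phi> k * (1 / 2 ^ n)))"
    using assms by (simp flip: ennreal_mult)
  also have "\<dots> = ennreal (\<Sum>k<2 ^ n. \<phi> k * (1 / 2 ^ n))"
    using assms by (intro sum_ennreal) auto
  also have "\<dots> = ennreal (mean n \<phi>)" by (simp add: mean_def sum_divide_distrib)
  finally show "(\<integral>\<^sup>+ x. ennreal (\<phi> (dyadic_index n x)) \<partial>unit_measure) = ennreal (mean n \<phi>)" .
qed

section \<open>Regularity of the exponent\<close>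

lemma AE_lebesgue_on_subset:
  assumes "A \<in> sets lebesgue" "A \<subseteq> {0..<1::real}"
  shows "(AE x in lebesgue_on A. P x) \<longleftrightarrow> (AE x in unit_measure. x \<in> A \<longrightarrow> P x)"
proof -
  have "(x \<in> A \<longrightarrow> P x) \<longleftrightarrow> (x \<in> {0..<1} \<longrightarrow> x \<in> A \<longrightarrow> P x)" for x using assms(2) by auto
  then show ?thesis using assms(1) by (simp add: AE_restrict_space_iff)
qed

lemma AE_p_plus: "AE x in lebesgue_on A. ereal (p x) \<le> p_plus p A"
  unfolding p_plus_def by (rule esssup_AE)

lemma AE_p_minus: "AE x in lebesgue_on A. p_minus p A \<le> ereal (p x)"
  using esssup_AE[of "\<lambda>x. ereal (- p x)" "lebesgue_on A"]
  by eventually_elim (metis p_minus_def ereal_uminus_le_reorder uminus_ereal.simps(1))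

text \<open>The conversion to reals is harmless: on a set of positive measure the essential bounds of an
  essentially bounded function are finite.\<close>

lemma AE_between_p_minus_p_plus:
  assumes A: "A \<in> sets lebesgue" "A \<subseteq> {0..<1}" "emeasure unit_measure A > 0"
    and p: "p \<in> borel_measurable unit_measure"
    and ae: "AE x in unit_measure. a \<le> p x \<and> p x \<le> b"
  shows "AE x in unit_measure. x \<in> A \<longrightarrow> real_of_ereal (p_minus p A) \<le> p x \<and> p x \<le> real_of_ereal (p_plus p A)"
proof -
  have pm: "p \<in> borel_measurable (lebesgue_on A)"
    using measurable_restrict_mono[OF p A(2)] .
  have ae': "AE x in lebesgue_on A. a \<le> p x \<and> p x \<le> b"
    unfolding AE_lebesgue_on_subset[OF A(1,2)] using ae by eventually_elim simp
  have nz: "\<not> (AE x in lebesgue_on A. False)"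
  proof
    assume "AE x in lebesgue_on A. False"
    then have "AE x in unit_measure. x \<notin> A" by (simp add: AE_lebesgue_on_subset[OF A(1,2)])
    moreover have "A \<in> sets unit_measure" using A(1,2) by (simp add: sets_restrict_space_iff)
    ultimately have "emeasure unit_measure A = 0"
      using AE_iff_null_sets[of A unit_measure] by auto
    then show False using A(3) by simp
  qed
  have "p_plus p A \<le> ereal b" unfolding p_plus_def
    using pm ae' by (intro esssup_I) auto
  moreover have "esssup (lebesgue_on A) (\<lambda>x. ereal (- p x)) \<le> ereal (- a)"
    using pm ae' by (intro esssup_I) auto
  then have "ereal a \<le> p_minus p A"
    unfolding p_minus_def by (metis ereal_minus_le_minus ereal_uminus_uminus uminus_ereal.simps(1))
  moreover have "p_plus p A \<noteq> -\<infinity>"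
  proof
    assume "p_plus p A = -\<infinity>"
    then have "AE x in lebesgue_on A. False" using AE_p_plus[of p A] by simp
    then show False using nz by simp
  qed
  moreover have "p_minus p A \<noteq> \<infinity>"
  proof
    assume "p_minus p A = \<infinity>"
    then have "AE x in lebesgue_on A. False" using AE_p_minus[of p A] by simp
    then show False using nz by simp
  qed
  ultimately obtain u v where uv: "p_plus p A = ereal u" "p_minus p A = ereal v"
    by (cases "p_plus p A"; cases "p_minus p A") auto
  have "AE x in lebesgue_on A. v \<le> p x \<and> p x \<le> u"
    using AE_p_plus[of p A] AE_p_minus[of p A] by eventually_elim (simp add: uv)
  then show ?thesis by (simp only: AE_lebesgue_on_subset[OF A(1,2)] uv real_of_ereal.simps)
qed

text \<open>There are countably many dyadic intervals, so outside a single null set \<open>p\<close> stays between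
  its essential bounds on each of them. On the remaining points the hypothesis on the essential
  oscillation is a pointwise statement.\<close>

lemma log_hoelder_good_set:
  fixes p :: "real \<Rightarrow> real" and K :: real
  assumes p: "p \<in> borel_measurable unit_measure"
    and minus: "1 < p_minus p {0..<1}" and le: "p_minus p {0..<1} \<le> p_plus p {0..<1}" and plus: "p_plus p {0..<1} < \<infinity>"
    and K: "\<And>n k. k < 2 ^ n \<Longrightarrow>
           measure unit_measure (dyadic_interval n k) powr
             (real_of_ereal (p_minus p (dyadic_interval n k)) -
              real_of_ereal (p_plus p (dyadic_interval n k))) \<le> K"
  obtains good where "AE x in unit_measure. good x"
    and "\<And>x. good x \<Longrightarrow> real_of_ereal (p_minus p {0..<1}) \<le> p x \<and> p x \<le> real_of_ereal (p_plus p {0..<1})"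
    and "\<And>x t j. good x \<Longrightarrow> good t \<Longrightarrow> x \<in> {0..<1} \<Longrightarrow> t \<in> {0..<1} \<Longrightarrow>
           dyadic_index j x = dyadic_index j t \<Longrightarrow> 2 powr (real j * (p x - p t)) \<le> K"
proof -
  let ?a = "\<lambda>A. real_of_ereal (p_minus p A)" and ?b = "\<lambda>A. real_of_ereal (p_plus p A)"
  have fin: "p_minus p {0..<1} = ereal (?a {0..<1})" "p_plus p {0..<1} = ereal (?b {0..<1})"
    using minus le plus by (cases "p_minus p {0..<1}"; cases "p_plus p {0..<1}"; auto)+
  have glob: "AE x in unit_measure. ?a {0..<1} \<le> p x \<and> p x \<le> ?b {0..<1}"
    using AE_p_plus[of p "{0..<1}"] AE_p_minus[of p "{0..<1}"]
    by eventually_elim (metis fin ereal_less_eq(3))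
  define good where "good x \<longleftrightarrow> (?a {0..<1} \<le> p x \<and> p x \<le> ?b {0..<1}) \<and>
    (\<forall>n k. k < 2 ^ n \<longrightarrow> x \<in> dyadic_interval n k \<longrightarrow>
      ?a (dyadic_interval n k) \<le> p x \<and> p x \<le> ?b (dyadic_interval n k))" for x
  show thesis
  proof (rule that[of good])
    have "AE x in unit_measure. k < 2 ^ n \<longrightarrow> x \<in> dyadic_interval n k \<longrightarrow>
      ?a (dyadic_interval n k) \<le> p x \<and> p x \<le> ?b (dyadic_interval n k)" for n k :: nat
    proof (cases "k < 2 ^ n")
      case True
      have "dyadic_interval n k \<in> sets lebesgue" by (simp add: dyadic_interval_def)
      then have "AE x in unit_measure. x \<in> dyadic_interval n k \<longrightarrow>
          ?a (dyadic_interval n k) \<le> p x \<and> p x \<le> ?b (dyadic_interval n k)"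
        by (rule AE_between_p_minus_p_plus[OF _ dyadic_interval_subset_unit[OF True] _ p glob])
          (simp add: measure_dyadic_interval(3)[OF True])
      then show ?thesis by eventually_elim simp
    qed simp
    then show "AE x in unit_measure. good x"
      unfolding good_def using glob by (simp add: AE_all_countable)
  next
    fix x t j
    assume xt: "good x" "good t" "x \<in> {0..<1}" "t \<in> {0..<1}" "dyadic_index j x = dyadic_index j t"
    let ?k = "dyadic_index j x"
    have k: "?k < 2 ^ j" using xt by (intro dyadic_index_less) auto
    have "x \<in> dyadic_interval j ?k" "t \<in> dyadic_interval j ?k"
      using xt by (auto simp: mem_dyadic_interval_iff)
    then have "p x - p t \<le> ?b (dyadic_interval j ?k) - ?a (dyadic_interval j ?k)"
      using xt(1,2) k unfolding good_def by (meson diff_mono)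
    then have "2 powr (real j * (p x - p t)) \<le> 2 powr (real j * (?b (dyadic_interval j ?k) - ?a (dyadic_interval j ?k)))"
      by (intro powr_mono mult_left_mono) auto
    also have "\<dots> = (1 / 2 ^ j) powr (?a (dyadic_interval j ?k) - ?b (dyadic_interval j ?k))"
    proof -
      have "1 / 2 ^ j = (2::real) powr (- real j)" by (simp add: powr_minus powr_realpow divide_inverse)
      then show ?thesis by (simp add: powr_powr algebra_simps)
    qed
    also have "\<dots> \<le> K" using K[OF k] by (simp add: measure_dyadic_interval(1)[OF k])
    finally show "2 powr (real j * (p x - p t)) \<le> K" .
  qed (simp add: good_def)
qed

section \<open>The pointwise estimate and the modular inequality\<close>

lemma powr_le_one_plus_powr:
  fixes t a b :: real
  assumes "0 \<le> t" "0 \<le> a" "a \<le> b"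
  shows "t powr a \<le> 1 + t powr b"
proof (cases "t \<le> 1")
  case True
  then have "t powr a \<le> 1" using assms by (intro powr_le1) auto
  then show ?thesis using powr_ge_zero[of t b] by linarith
next
  case False
  then have "t powr a \<le> t powr b" using assms by (intro powr_mono) auto
  then show ?thesis by simp
qed

lemma geometric_deriv_bound:
  fixes \<rho> :: real
  assumes "0 \<le> \<rho>" "\<rho> < 1"
  shows "(\<Sum>d<n. (real d + 1) * \<rho> ^ d) \<le> 1 / (1 - \<rho>)\<^sup>2"
proof -
  have s: "(\<lambda>d. (real d + 1) * \<rho> ^ d) sums (1 / (1 - \<rho>)\<^sup>2)"
    using geometric_deriv_sums[of \<rho>] assms by (simp add: add.commute)
  have "(\<Sum>d<n. (real d + 1) * \<rho> ^ d) \<le> (\<Sum>d. (real d + 1) * \<rho> ^ d)"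
    using assms by (intro sum_le_suminf sums_summable[OF s]) auto
  then show ?thesis using s by (simp add: sums_iff)
qed

text \<open>With \<open>\<gamma> < \<alpha> + s\<close> the growth \<open>2\<^bsup>(i-j)\<gamma>\<^esup>\<close> is absorbed, and geometric decay in both \<open>n - j\<close> and
  \<open>i - j\<close> is left. The exponent on the left is \<open>- (n - i) \<alpha> - (i - j) (\<alpha> + s - \<gamma>)\<close>.\<close>

lemma weight_le:
  fixes n i j \<alpha> s \<gamma> \<epsilon> :: real
  assumes "j \<le> i" "i \<le> n" "\<epsilon> \<le> \<alpha>" "\<epsilon> \<le> \<alpha> + s - \<gamma>" "0 \<le> \<epsilon>"
  shows "2 powr ((j - n) * \<alpha>) * 2 powr ((j - i) * s) * 2 powr ((i - j) * \<gamma>) \<le>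
    2 powr (- (\<epsilon> / 2) * (n - j)) * 2 powr (- (\<epsilon> / 2) * (i - j))"
proof -
  have "(n - i) * \<epsilon> \<le> (n - i) * \<alpha>" "(i - j) * \<epsilon> \<le> (i - j) * (\<alpha> + s - \<gamma>)" "0 \<le> (n - i) * \<epsilon>"
    using assms by (auto intro!: mult_left_mono)
  moreover have "(j - n) * \<alpha> + (j - i) * s + (i - j) * \<gamma> = - ((n - i) * \<alpha>) - (i - j) * (\<alpha> + s - \<gamma>)"
    by (simp add: algebra_simps)
  moreover have "- (\<epsilon> / 2) * (n - j) + - (\<epsilon> / 2) * (i - j) = - ((n - i) * \<epsilon>) / 2 - (i - j) * \<epsilon>"
    by (simp add: field_simps)
  ultimately have "(j - n) * \<alpha> + (j - i) * s + (i - j) * \<gamma> \<le> - (\<epsilon> / 2) * (n - j) + - (\<epsilon> / 2) * (i - j)"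
    by linarith
  then show ?thesis by (simp flip: powr_add)
qed

lemma shifted_max_nonneg: "(\<And>i m. 0 \<le> \<phi> i m) \<Longrightarrow> 0 \<le> shifted_max d \<phi> t k"
  by (cases t) (auto simp: le_max_iff_disj)

text \<open>\<open>F\<close> has modular at most \<open>1\<close>, \<open>pm\<close> and \<open>pp\<close> stand for \<open>p\<^sub>-\<close> and \<open>p\<^sub>+\<close>, and \<open>good\<close> describes
  the conull set on which the regularity of \<open>p\<close> is available pointwise.\<close>

context
  fixes p F :: "real \<Rightarrow> real" and good :: "real \<Rightarrow> bool" and pm pp K :: real
  assumes p_measurable: "p \<in> borel_measurable unit_measure"
    and F_measurable: "F \<in> borel_measurable unit_measure"
    and pm: "1 < pm" and pm_le_pp: "pm \<le> pp" and K: "1 \<le> K"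
    and good_AE: "AE x in unit_measure. good x"
    and good_bounds: "\<And>x. good x \<Longrightarrow> pm \<le> p x \<and> p x \<le> pp"
    and good_oscillation: "\<And>x t j. good x \<Longrightarrow> good t \<Longrightarrow> x \<in> {0..<1} \<Longrightarrow> t \<in> {0..<1} \<Longrightarrow>
           dyadic_index j x = dyadic_index j t \<Longrightarrow> 2 powr (real j * (p x - p t)) \<le> K"
    and F_modular: "(\<integral>\<^sup>+ x. ennreal (\<bar>F x\<bar> powr p x) \<partial>unit_measure) \<le> 1"
begin

text \<open>\<open>|F|\<^sup>q\<close> for \<open>q = p / p\<^sub>-\<close>. Its \<open>p\<^sub>-\<close>-th power is \<open>|F|\<^sup>p\<close>, and \<open>q \<ge> 1\<close> almost everywhere.\<close>

definition reduced_power :: "real \<Rightarrow> real" where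
  "reduced_power x = \<bar>F x\<bar> powr (p x / pm)"

text \<open>The summand \<open>1\<close> makes the averages over subintervals of \<open>[0,1)\<close> at least \<open>1\<close>, so that
  their powers increase with the exponent.\<close>

abbreviation h :: "real \<Rightarrow> real" where "h \<equiv> \<lambda>x. reduced_power x + 1"

abbreviation H :: "nat \<Rightarrow> nat \<Rightarrow> real" where "H \<equiv> dyadic_average h"

lemma reduced_power_nonneg: "0 \<le> reduced_power x"
  by (simp add: reduced_power_def)

lemma reduced_power_powr: "reduced_power x powr pm = \<bar>F x\<bar> powr p x"
  using pm by (simp add: reduced_power_def powr_powr)

lemma powr_F_measurable: "(\<lambda>x. \<bar>F x\<bar> powr p x) \<in> borel_measurable unit_measure"
  using F_measurable p_measurable by measurable

lemma integrable_powr_p: "integrable unit_measure (\<lambda>x. \<bar>F x\<bar> powr p x)"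
  by (rule integrableI_nonneg[OF powr_F_measurable])
    (use F_modular in \<open>auto intro: le_less_trans\<close>)

lemma integral_powr_p: "(LINT x|unit_measure. \<bar>F x\<bar> powr p x) \<le> 1"
proof -
  have "ennreal (LINT x|unit_measure. \<bar>F x\<bar> powr p x) \<le> 1"
    using F_modular nn_integral_eq_integral[OF integrable_powr_p] by simp
  then show ?thesis by simp
qed

lemma integrable_le_one_plus_powr_p:
  assumes "g \<in> borel_measurable unit_measure"
    and "\<And>x. good x \<Longrightarrow> \<bar>g x\<bar> \<le> 1 + \<bar>F x\<bar> powr p x"
  shows "integrable unit_measure g"
proof (rule Bochner_Integration.integrable_bound)
  show "integrable unit_measure (\<lambda>x. 1 + \<bar>F x\<bar> powr p x)"
    by (intro Bochner_Integration.integrable_add integrable_unit_const integrable_powr_p)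
  show "AE x in unit_measure. norm (g x) \<le> norm (1 + \<bar>F x\<bar> powr p x)"
    using good_AE by eventually_elim (use assms(2) in force)
qed (rule assms)

lemma integrable_F: "integrable unit_measure F"
proof (rule integrable_le_one_plus_powr_p[OF F_measurable])
  fix x assume "good x"
  then show "\<bar>F x\<bar> \<le> 1 + \<bar>F x\<bar> powr p x"
    using powr_le_one_plus_powr[of "\<bar>F x\<bar>" 1 "p x"] good_bounds[of x] pm by simp
qed

lemma integrable_reduced_power: "integrable unit_measure reduced_power"
proof (rule integrable_le_one_plus_powr_p)
  show "reduced_power \<in> borel_measurable unit_measure"
    unfolding reduced_power_def using F_measurable p_measurable by measurable
  fix x assume "good x"
  then have p: "0 < p x" using good_bounds[of x] pm by simp
  then have "p x / pm \<le> p x" using pm by (simp add: divide_le_eq)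
  then show "\<bar>reduced_power x\<bar> \<le> 1 + \<bar>F x\<bar> powr p x"
    using powr_le_one_plus_powr[of "\<bar>F x\<bar>" "p x / pm" "p x"] p pm by (simp add: reduced_power_def)
qed

lemma integrable_h: "integrable unit_measure h"
  by (intro Bochner_Integration.integrable_add integrable_unit_const integrable_reduced_power)

lemma h_powr_le: "h x powr pm \<le> 2 powr pm * (\<bar>F x\<bar> powr p x + 1)"
proof -
  let ?a = "reduced_power x"
  have "h x powr pm \<le> (2 * max ?a 1) powr pm"
    using pm reduced_power_nonneg[of x] by (intro powr_mono2) auto
  also have "\<dots> = 2 powr pm * max ?a 1 powr pm" by (simp add: powr_mult)
  also have "max ?a 1 powr pm \<le> ?a powr pm + 1" by (auto simp: max_def)
  finally show ?thesis by (simp add: reduced_power_powr)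
qed

lemma integrable_h_powr: "integrable unit_measure (\<lambda>x. h x powr pm)"
proof (rule Bochner_Integration.integrable_bound)
  show "integrable unit_measure (\<lambda>x. 2 powr pm * (\<bar>F x\<bar> powr p x + 1))"
    by (intro integrable_mult_right Bochner_Integration.integrable_add integrable_unit_const integrable_powr_p)
  show "(\<lambda>x. h x powr pm) \<in> borel_measurable unit_measure"
    using integrable_h by measurable
  show "AE x in unit_measure. norm (h x powr pm) \<le> norm (2 powr pm * (\<bar>F x\<bar> powr p x + 1))"
    using h_powr_le by (intro AE_I2) (simp add: abs_mult)
qed

lemma integral_h_powr: "(LINT x|unit_measure. h x powr pm) \<le> 2 * 2 powr pm"
proof -
  have "(LINT x|unit_measure. h x powr pm) \<le> (LINT x|unit_measure. 2 powr pm * (\<bar>F x\<bar> powr p x + 1))"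
    using h_powr_le by (intro integral_mono integrable_h_powr integrable_mult_right
      Bochner_Integration.integrable_add integrable_unit_const integrable_powr_p)
  also have "\<dots> = 2 powr pm * ((LINT x|unit_measure. \<bar>F x\<bar> powr p x) + 1)"
  proof -
    have "measure unit_measure {0..<1} = 1" using measure_dyadic_interval(1)[of 0 0] by (simp add: dyadic_interval_def)
    then show ?thesis
      by (simp add: integrable_powr_p integrable_unit_const)
  qed
  also have "\<dots> \<le> 2 powr pm * (1 + 1)"
    by (intro mult_left_mono add_right_mono integral_powr_p) auto
  finally show ?thesis by simp
qed

lemma H_nonneg: "0 \<le> H i m"
  using reduced_power_nonneg by (intro dyadic_average_nonneg) (simp add: add_nonneg_nonneg)

lemma H_eq: "m < 2 ^ i \<Longrightarrow> H i m = dyadic_average reduced_power i m + 1"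
  by (subst dyadic_average_add) (auto simp: integrable_reduced_power integrable_unit_const dyadic_average_const)

lemma H_ge_1: "m < 2 ^ i \<Longrightarrow> 1 \<le> H i m"
  using dyadic_average_nonneg[OF reduced_power_nonneg] by (simp add: H_eq)

lemma H_le:
  assumes m: "m < 2 ^ i"
  shows "H i m \<le> 3 * 2 powr (real i / pm)"
proof -
  let ?A = "dyadic_average reduced_power i m"
  have "?A powr pm \<le> 2 powr pm * dyadic_average (\<lambda>x. reduced_power x powr pm) i m"
    by (rule dyadic_average_powr_le)
      (use pm m integrable_powr_p in \<open>auto simp: reduced_power_powr reduced_power_nonneg integrable_reduced_power\<close>)
  also have "dyadic_average (\<lambda>x. reduced_power x powr pm) i m \<le> 2 ^ i * (LINT x|unit_measure. \<bar>F x\<bar> powr p x)"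
    unfolding reduced_power_powr by (intro dyadic_average_le_integral integrable_powr_p) simp
  also have "\<dots> \<le> 2 ^ i * 1" by (intro mult_left_mono integral_powr_p) simp
  also have "2 powr pm * (2 ^ i * 1) = (2 * 2 powr (real i / pm)) powr pm"
    using pm by (simp add: powr_mult powr_powr powr_realpow)
  finally have "?A powr pm \<le> (2 * 2 powr (real i / pm)) powr pm" by simp
  then have "?A \<le> 2 * 2 powr (real i / pm)"
    using powr_less_mono2[of pm "2 * 2 powr (real i / pm)" ?A] pm by (force simp: not_le[symmetric])
  moreover have "1 \<le> 2 powr (real i / pm)" using pm by (intro ge_one_powr_ge_zero) auto
  ultimately show ?thesis using m by (simp add: H_eq)
qed

text \<open>Here \<open>x\<close> need not lie in the interval \<open>J\<close> with index \<open>m\<close>; it shares with it the ancestor of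
  level \<open>j\<close>.\<close>

lemma average_le:
  fixes x :: real
  assumes x: "good x" "x \<in> {0..<1}" and ji: "j \<le> i" and m: "m < 2 ^ i"
    and anc: "m div 2 ^ (i - j) = dyadic_index j x"
  shows "dyadic_average (\<lambda>t. \<bar>F t\<bar>) i m
    \<le> 6 * K * 2 powr ((real i - real j) * (1 / pm - 1 / pp)) * H i m powr (pm / p x)"
proof -
  define \<gamma> where "\<gamma> = 1 / pm - 1 / pp"
  define B where "B = 3 * K * 2 powr ((real i - real j) * \<gamma>)"
  define c where "c = B * H i m powr (pm / p x)"
  have \<gamma>: "0 \<le> \<gamma>" using pm pm_le_pp by (simp add: \<gamma>_def frac_le)
  have "1 \<le> 2 powr ((real i - real j) * \<gamma>)" using ji \<gamma> by (intro ge_one_powr_ge_zero mult_nonneg_nonneg) auto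
  then have "1 * 1 \<le> (3 * K) * 2 powr ((real i - real j) * \<gamma>)" using K by (intro mult_mono) auto
  then have B: "1 \<le> B" by (simp add: B_def)
  have H1: "1 \<le> H i m" by (rule H_ge_1[OF m])
  have c: "0 < c" using B H1 by (simp add: c_def)
  have px: "pm \<le> p x" "p x \<le> pp" using good_bounds[OF x(1)] by auto
  have key: "H i m powr (pm / p t) \<le> c" if t: "good t" "t \<in> {0..<1}" "t \<in> dyadic_interval i m" for t
  proof -
    have pt: "pm \<le> p t" "p t \<le> pp" using good_bounds[OF t(1)] by auto
    define \<delta> where "\<delta> = pm / p t - pm / p x"
    define \<eta> where "\<eta> = 1 / p t - 1 / p x"
    have \<delta>\<eta>: "\<delta> = pm * \<eta>" by (simp add: \<delta>_def \<eta>_def right_diff_distrib)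
    \<comment> \<open>Only the case \<open>p t < p x\<close> needs the upper bound for \<open>H\<close>; there
      \<open>2\<^bsup>i\<eta>\<^esup> = 2\<^bsup>(i-j)\<eta>\<^esup> 2\<^bsup>j\<eta>\<^esup>\<close>, and the last factor is controlled by the oscillation of \<open>p\<close> on the common
      ancestor.\<close>
    have "H i m powr \<delta> \<le> B"
    proof (cases "\<delta> \<le> 0")
      case True
      then have "H i m powr \<delta> \<le> H i m powr 0" using H1 by (intro powr_mono) auto
      then show ?thesis using B H1 by simp
    next
      case False
      have "pm / p t \<le> 1" "0 \<le> pm / p x" using pt px pm by auto
      then have \<delta>1: "\<delta> \<le> 1" by (simp add: \<delta>_def)
      have \<eta>0: "0 < \<eta>" using False pm by (simp add: \<delta>\<eta> not_le zero_less_mult_iff)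
      have "1 / p t \<le> 1 / pm" "1 / pp \<le> 1 / p x" using pt px pm by (auto intro!: divide_left_mono)
      then have \<eta>\<gamma>: "\<eta> \<le> \<gamma>" by (simp add: \<eta>_def \<gamma>_def)
      have "\<eta> = (p x - p t) / (p t * p x)" using pt px pm by (simp add: \<eta>_def field_simps)
      moreover have pos: "0 < p t" "0 < p x" "1 \<le> p t * p x"
        using pt px pm mult_mono[of 1 "p t" 1 "p x"] by auto
      ultimately have "p x - p t = \<eta> * (p t * p x)" by simp
      then have "\<eta> \<le> p x - p t" using \<eta>0 pos mult_left_mono[of 1 "p t * p x" \<eta>] by simp
      then have j\<eta>: "real j * \<eta> \<le> real j * (p x - p t)" by (intro mult_left_mono) auto
      have "dyadic_index j t = dyadic_index i t div 2 ^ (i - j)" using dyadic_index_div[OF ji, of t] by simp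
      also have "dyadic_index i t = m" using t by (simp add: mem_dyadic_interval_iff)
      finally have "dyadic_index j x = dyadic_index j t" using anc by simp
      then have osc: "2 powr (real j * (p x - p t)) \<le> K"
        by (rule good_oscillation[OF x(1) t(1) x(2) t(2)])
      have "H i m powr \<delta> \<le> (3 * 2 powr (real i / pm)) powr \<delta>"
        using False H_le[OF m] H1 by (intro powr_mono2) auto
      also have "\<dots> = 3 powr \<delta> * 2 powr (real i * \<eta>)"
        using pm by (simp add: powr_mult powr_powr \<delta>\<eta>)
      also have "real i * \<eta> = (real i - real j) * \<eta> + real j * \<eta>" by (simp add: algebra_simps)
      also have "3 powr \<delta> * 2 powr ((real i - real j) * \<eta> + real j * \<eta>) \<le>
          3 powr 1 * 2 powr ((real i - real j) * \<gamma> + real j * (p x - p t))"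
      proof (intro mult_mono powr_mono)
        have "(real i - real j) * \<eta> \<le> (real i - real j) * \<gamma>"
          using \<eta>\<gamma> ji by (intro mult_left_mono) auto
        then show "(real i - real j) * \<eta> + real j * \<eta> \<le> (real i - real j) * \<gamma> + real j * (p x - p t)"
          using j\<eta> by linarith
      qed (use \<delta>1 in auto)
      also have "\<dots> = 3 * 2 powr ((real i - real j) * \<gamma>) * 2 powr (real j * (p x - p t))"
        by (simp add: powr_add)
      also have "\<dots> \<le> 3 * 2 powr ((real i - real j) * \<gamma>) * K"
        using osc by (intro mult_left_mono) auto
      finally show ?thesis by (simp add: B_def mult_ac)
    qed
    then have "H i m powr \<delta> * H i m powr (pm / p x) \<le> B * H i m powr (pm / p x)"
      by (intro mult_right_mono) auto
    then show ?thesis by (simp add: c_def \<delta>_def flip: powr_add)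
  qed
  have bound: "\<bar>F t\<bar> \<le> c + c / H i m * reduced_power t"
    if t: "good t" "t \<in> {0..<1}" "t \<in> dyadic_interval i m" for t
  proof -
    let ?q = "p t / pm"
    have q: "1 \<le> ?q" using good_bounds[OF t(1)] pm by simp
    have "H i m = (H i m powr (pm / p t)) powr ?q" using q pm H1 by (simp add: powr_powr)
    also have "\<dots> \<le> c powr ?q" using key[OF t] q by (intro powr_mono2) auto
    finally have Hc: "H i m \<le> c powr ?q" .
    have "c powr (1 - ?q) = c / c powr ?q" using c by (simp add: powr_diff)
    also have "\<dots> \<le> c / H i m" using Hc H1 c by (intro divide_left_mono) auto
    finally have "c powr (1 - ?q) * \<bar>F t\<bar> powr ?q \<le> c / H i m * \<bar>F t\<bar> powr ?q"
      by (intro mult_right_mono) auto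
    then show ?thesis using le_add_powr[of c "\<bar>F t\<bar>" ?q] c q by (simp add: reduced_power_def)
  qed
  have int: "integrable unit_measure (\<lambda>t. c / H i m * reduced_power t)"
    by (intro integrable_mult_right integrable_reduced_power)
  have unit: "AE t in unit_measure. t \<in> {0..<1}" by (rule AE_I2) simp
  have "dyadic_average (\<lambda>t. \<bar>F t\<bar>) i m \<le> dyadic_average (\<lambda>t. c + c / H i m * reduced_power t) i m"
  proof (rule dyadic_average_mono_AE)
    show "AE t in unit_measure. t \<in> dyadic_interval i m \<longrightarrow> \<bar>F t\<bar> \<le> c + c / H i m * reduced_power t"
      using good_AE unit by eventually_elim (use bound in blast)
  qed (use integrable_F int in \<open>auto intro: integrable_unit_const\<close>)
  also have "\<dots> = c + c / H i m * dyadic_average reduced_power i m"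
    by (simp only: dyadic_average_add[OF integrable_unit_const int] dyadic_average_const[OF m] dyadic_average_cmult)
  also have "\<dots> \<le> c + c / H i m * H i m"
    using c H1 by (intro add_left_mono mult_left_mono) (auto simp: H_eq[OF m])
  also have "\<dots> = 2 * c" using H1 by simp
  finally show ?thesis by (simp add: c_def B_def \<gamma>_def mult_ac)
qed

text \<open>The function \<open>Z\<close> that dominates \<open>V F\<close>, truncated to level \<open>n\<close>, on the interval with index \<open>k\<close>:
  the shifted maximal functions of the averages of \<open>h\<close>, with geometric weights in the shift.\<close>

definition control :: "real \<Rightarrow> nat \<Rightarrow> nat \<Rightarrow> real" where
  "control \<rho> n k = (\<Sum>d\<le>n. \<rho> ^ d * shifted_max d (\<lambda>i m. running_max H i m powr pm) (n - d) k)"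

lemma control_nonneg: "0 \<le> \<rho> \<Longrightarrow> 0 \<le> control \<rho> n k"
  unfolding control_def by (intro sum_nonneg mult_nonneg_nonneg shifted_max_nonneg) auto

lemma control_mono:
  assumes "0 \<le> \<rho>"
  shows "control \<rho> n (k div 2) \<le> control \<rho> (Suc n) k"
proof -
  let ?S = "\<lambda>d. shifted_max d (\<lambda>i m. running_max H i m powr pm)"
  have "control \<rho> n (k div 2) \<le> (\<Sum>d\<le>n. \<rho> ^ d * ?S d (Suc n - d) k)"
    unfolding control_def using assms by (intro sum_mono mult_left_mono) (auto simp: Suc_diff_le)
  also have "\<dots> \<le> control \<rho> (Suc n) k"
    unfolding control_def using assms
    by (simp del: shifted_max.simps) (intro mult_nonneg_nonneg shifted_max_nonneg, auto)
  finally show ?thesis .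
qed

lemma control_ge:
  assumes "0 \<le> \<rho>" "j \<le> i" "i \<le> n"
  shows "\<rho> ^ (i - j) * H i (dyadic_shift (i - j) (k div 2 ^ (n - i))) powr pm \<le> control \<rho> n k"
proof -
  let ?\<phi> = "\<lambda>i m. running_max H i m powr pm" and ?d = "i - j"
  let ?m = "dyadic_shift ?d (k div 2 ^ (n - i))"
  have "H i ?m powr pm \<le> ?\<phi> i ?m"
    using pm by (intro powr_mono2 running_max_ge H_nonneg) auto
  also have "\<dots> \<le> shifted_max ?d ?\<phi> (n - ?d) k"
    using shifted_max_ge[of j "n - ?d" ?\<phi> ?d k] assms by simp
  finally have "\<rho> ^ ?d * H i ?m powr pm \<le> \<rho> ^ ?d * shifted_max ?d ?\<phi> (n - ?d) k"
    using assms by (intro mult_left_mono) auto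
  also have "\<dots> \<le> control \<rho> n k"
    unfolding control_def using assms
    by (intro member_le_sum[of ?d "{..n}" "\<lambda>d. \<rho> ^ d * shifted_max d ?\<phi> (n - d) k"])
      (auto intro!: mult_nonneg_nonneg shifted_max_nonneg)
  finally show ?thesis .
qed

lemma mean_control:
  assumes "0 \<le> \<rho>" "\<rho> < 1"
  shows "mean n (control \<rho> n) \<le> 1 / (1 - \<rho>)\<^sup>2 * ((2 * pm / (pm - 1)) powr pm * (2 powr pm * (2 * 2 powr pm)))"
proof -
  let ?\<phi> = "\<lambda>i m. running_max H i m powr pm"
  let ?C = "(2 * pm / (pm - 1)) powr pm" and ?M = "mean n (\<lambda>m. H n m powr pm)"
  have "?M \<le> mean n (\<lambda>m. 2 powr pm * dyadic_average (\<lambda>x. h x powr pm) n m)"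
    using pm reduced_power_nonneg
    by (intro mean_mono dyadic_average_powr_le integrable_h integrable_h_powr) (auto simp: add_nonneg_nonneg)
  also have "\<dots> = 2 powr pm * (LINT x|unit_measure. h x powr pm)"
    by (simp only: mean_cmult mean_dyadic_average[OF integrable_h_powr])
  also have "\<dots> \<le> 2 powr pm * (2 * 2 powr pm)" by (intro mult_left_mono integral_h_powr) auto
  finally have M: "?M \<le> 2 powr pm * (2 * 2 powr pm)" .
  have M0: "0 \<le> ?C * ?M" by (simp add: mean_def sum_nonneg)
  have sh: "mean n (shifted_max d ?\<phi> (n - d)) \<le> (real d + 1) * (?C * ?M)" if "d \<le> n" for d
    using shifted_maximal[of H pm d "n - d", OF dyadic_average_martingale[OF integrable_h] H_nonneg pm] that by simp
  have "mean n (control \<rho> n) = (\<Sum>d\<le>n. \<rho> ^ d * mean n (shifted_max d ?\<phi> (n - d)))"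
    unfolding control_def mean_def
    by (subst sum.swap) (simp add: sum_distrib_left sum_divide_distrib)
  also have "\<dots> \<le> (\<Sum>d\<le>n. \<rho> ^ d * ((real d + 1) * (?C * ?M)))"
    using assms sh by (intro sum_mono mult_left_mono) auto
  also have "\<dots> = (\<Sum>d<Suc n. (real d + 1) * \<rho> ^ d) * (?C * ?M)"
    unfolding sum_distrib_right lessThan_Suc_atMost by (rule sum.cong) (auto simp: mult_ac)
  also have "\<dots> \<le> 1 / (1 - \<rho>)\<^sup>2 * (?C * ?M)"
    by (intro mult_right_mono geometric_deriv_bound assms M0)
  also have "\<dots> \<le> 1 / (1 - \<rho>)\<^sup>2 * (?C * (2 powr pm * (2 * 2 powr pm)))"
    using M by (intro mult_left_mono) auto
  finally show ?thesis .
qed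

lemma V_term_le:
  fixes \<alpha> s \<epsilon> :: real and n k i j :: nat
  defines "\<rho> \<equiv> 2 powr (- (\<epsilon> / 2))"
  assumes \<epsilon>: "0 < \<epsilon>" "\<epsilon> \<le> \<alpha>" "\<epsilon> \<le> \<alpha> + s - (1 / pm - 1 / pp)"
    and x: "good x" "x \<in> {0..<1}" and k: "k = dyadic_index n x" and ji: "j \<le> i" and i_n: "i < n"
  shows "2 powr ((real j - real n) * \<alpha>) * 2 powr ((real j - real i) * s) *
          (1 / measure unit_measure (shifted_interval (dyadic_interval n k) j i)) *
          \<bar>set_lebesgue_integral unit_measure (shifted_interval (dyadic_interval n k) j i) F\<bar>
     \<le> 6 * K * \<rho> ^ (n - j) * control \<rho> n k powr (1 / p x)"
proof -
  let ?d = "i - j"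
  let ?m = "dyadic_shift ?d (k div 2 ^ (n - i))"
  define \<gamma> where "\<gamma> = 1 / pm - 1 / pp"
  let ?w = "2 powr ((real j - real n) * \<alpha>) * 2 powr ((real j - real i) * s)"
  let ?Hp = "H i ?m powr (pm / p x)"
  have \<rho>: "0 < \<rho>" "\<rho> \<le> 1" using \<epsilon> powr_mono[of "- (\<epsilon> / 2)" 0 2] by (auto simp: \<rho>_def)
  have \<rho>_pow: "2 powr (- (\<epsilon> / 2) * real l) = \<rho> ^ l" for l
    unfolding \<rho>_def by (subst powr_powr[symmetric], rule powr_realpow) simp
  have px: "1 \<le> p x" using good_bounds[OF x(1)] pm by simp
  have k_less: "k < 2 ^ n" unfolding k using x(2) by (intro dyadic_index_less) auto
  have m: "?m < 2 ^ i" by (rule shifted_interval_bounds(1)[OF k_less ji i_n])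
  have "?m div 2 ^ ?d = k div 2 ^ (n - i) div 2 ^ (i - j)" by (rule dyadic_shift_div)
  also have "\<dots> = dyadic_index j x" using ji i_n by (simp add: k dyadic_index_div)
  finally have anc: "?m div 2 ^ ?d = dyadic_index j x" .
  note avg = average_shifted_interval[OF k_less ji i_n F_measurable]
  have "(1 / measure unit_measure (shifted_interval (dyadic_interval n k) j i)) *
      \<bar>set_lebesgue_integral unit_measure (shifted_interval (dyadic_interval n k) j i) F\<bar> = \<bar>dyadic_average F i ?m\<bar>"
    by (simp only: avg) (simp add: dyadic_average_def set_lebesgue_integral_def abs_mult)
  also have "\<dots> \<le> dyadic_average (\<lambda>t. \<bar>F t\<bar>) i ?m" by (rule abs_dyadic_average_le)
  also have "\<dots> \<le> 6 * K * 2 powr ((real i - real j) * \<gamma>) * ?Hp"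
    unfolding \<gamma>_def by (rule average_le[OF x ji m anc])
  finally have "?w * ((1 / measure unit_measure (shifted_interval (dyadic_interval n k) j i)) *
      \<bar>set_lebesgue_integral unit_measure (shifted_interval (dyadic_interval n k) j i) F\<bar>) \<le>
      ?w * (6 * K * 2 powr ((real i - real j) * \<gamma>) * ?Hp)"
    by (intro mult_left_mono) auto
  also have "\<dots> = 6 * K * (?w * 2 powr ((real i - real j) * \<gamma>)) * ?Hp" by (simp only: mult_ac)
  also have "?w * 2 powr ((real i - real j) * \<gamma>) \<le>
      2 powr (- (\<epsilon> / 2) * (real n - real j)) * 2 powr (- (\<epsilon> / 2) * (real i - real j))"
    using \<epsilon> ji i_n unfolding \<gamma>_def[symmetric] by (intro weight_le) auto
  also have "\<dots> = \<rho> ^ (n - j) * \<rho> ^ ?d"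
    using ji i_n \<rho>_pow[of "n - j"] \<rho>_pow[of ?d] by (simp add: of_nat_diff)
  also have "6 * K * (\<rho> ^ (n - j) * \<rho> ^ ?d) * ?Hp = 6 * K * \<rho> ^ (n - j) * (\<rho> ^ ?d * ?Hp)" by simp
  \<comment> \<open>\<open>\<rho> \<le> 1 \<le> p x\<close> allows moving the weight under the power \<open>1 / p x\<close>.\<close>
  also have "\<rho> ^ ?d * ?Hp \<le> control \<rho> n k powr (1 / p x)"
  proof -
    have "0 < \<rho> ^ ?d" "\<rho> ^ ?d \<le> 1" using \<rho> by (auto intro: power_le_one)
    then have "\<rho> ^ ?d \<le> (\<rho> ^ ?d) powr (1 / p x)"
      using px powr_mono'[of "1 / p x" 1 "\<rho> ^ ?d"] by simp
    then have "\<rho> ^ ?d * ?Hp \<le> (\<rho> ^ ?d) powr (1 / p x) * (H i ?m powr pm) powr (1 / p x)"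
      by (intro mult_mono) (auto simp: powr_powr)
    also have "\<dots> = (\<rho> ^ ?d * H i ?m powr pm) powr (1 / p x)"
      using \<rho> by (simp add: powr_mult)
    also have "\<dots> \<le> control \<rho> n k powr (1 / p x)"
      using \<rho> px ji i_n by (intro powr_mono2 control_ge) auto
    finally show ?thesis .
  qed
  finally show ?thesis using K \<rho> by (simp only: mult.assoc) (simp add: mult_left_mono mult_right_mono)
qed

lemma V_sum_le:
  fixes \<alpha> s \<epsilon> :: real and n k :: nat
  defines "\<rho> \<equiv> 2 powr (- (\<epsilon> / 2))"
  assumes \<epsilon>: "0 < \<epsilon>" "\<epsilon> \<le> \<alpha>" "\<epsilon> \<le> \<alpha> + s - (1 / pm - 1 / pp)"
    and x: "good x" "x \<in> {0..<1}" and k: "k = dyadic_index n x"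
  shows "(\<Sum>j = 0..<n. \<Sum>i = j..<n.
          2 powr ((real j - real n) * \<alpha>) * 2 powr ((real j - real i) * s) *
          (1 / measure unit_measure (shifted_interval (dyadic_interval n k) j i)) *
          \<bar>set_lebesgue_integral unit_measure (shifted_interval (dyadic_interval n k) j i) F\<bar>)
     \<le> 6 * K / (1 - \<rho>)\<^sup>2 * control \<rho> n k powr (1 / p x)" (is "?L \<le> _")
proof -
  let ?c = "control \<rho> n k powr (1 / p x)"
  have \<rho>: "0 < \<rho>" "\<rho> < 1" using \<epsilon> powr_less_mono[of "- (\<epsilon> / 2)" 0 2] by (auto simp: \<rho>_def)
  have "?L \<le> (\<Sum>j = 0..<n. \<Sum>i = j..<n. 6 * K * \<rho> ^ (n - j) * ?c)"
    unfolding \<rho>_def using x k \<epsilon> by (intro sum_mono V_term_le) auto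
  also have "\<dots> = 6 * K * (\<Sum>j = 0..<n. real (n - j) * \<rho> ^ (n - j)) * ?c"
    by (simp add: sum_distrib_left sum_distrib_right mult_ac)
  also have "(\<Sum>j = 0..<n. real (n - j) * \<rho> ^ (n - j)) = (\<Sum>l<n. real (Suc l) * \<rho> ^ Suc l)"
    unfolding atLeast0LessThan by (subst sum.nat_diff_reindex[symmetric]) (auto intro!: sum.cong simp: Suc_diff_Suc)
  also have "6 * K * \<dots> * ?c \<le> 6 * K * (1 / (1 - \<rho>)\<^sup>2) * ?c"
  proof (intro mult_right_mono mult_left_mono)
    have "(\<Sum>l<n. real (Suc l) * \<rho> ^ Suc l) \<le> (\<Sum>l<n. (real l + 1) * \<rho> ^ l)"
      using \<rho> by (intro sum_mono mult_mono) (auto simp: mult_left_le_one_le)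
    also have "\<dots> \<le> 1 / (1 - \<rho>)\<^sup>2" using \<rho> by (intro geometric_deriv_bound) auto
    finally show "(\<Sum>l<n. real (Suc l) * \<rho> ^ Suc l) \<le> 1 / (1 - \<rho>)\<^sup>2" .
  qed (use K in auto)
  finally show ?thesis by simp
qed

lemma nn_integral_control:
  fixes \<rho> :: real
  assumes "0 \<le> \<rho>" "\<rho> < 1"
  shows "(\<lambda>x. SUP n. ennreal (control \<rho> n (dyadic_index n x))) \<in> borel_measurable unit_measure"
    and "(\<integral>\<^sup>+ x. (SUP n. ennreal (control \<rho> n (dyadic_index n x))) \<partial>unit_measure) \<le>
      ennreal (1 / (1 - \<rho>)\<^sup>2 * ((2 * pm / (pm - 1)) powr pm * (2 powr pm * (2 * 2 powr pm))))"
proof -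
  note step = nn_integral_dyadic_step[of "control \<rho> n" n for n, OF control_nonneg[OF assms(1)]]
  show "(\<lambda>x. SUP n. ennreal (control \<rho> n (dyadic_index n x))) \<in> borel_measurable unit_measure"
    by (intro borel_measurable_SUP step(1)) auto
  have inc: "incseq (\<lambda>n x. ennreal (control \<rho> n (dyadic_index n x)))"
  proof (intro incseq_SucI le_funI ennreal_leI)
    fix n x
    show "control \<rho> n (dyadic_index n x) \<le> control \<rho> (Suc n) (dyadic_index (Suc n) x)"
      using control_mono[OF assms(1), of n "dyadic_index (Suc n) x"] by (simp only: dyadic_index_Suc_div)
  qed
  have "(\<integral>\<^sup>+ x. (SUP n. ennreal (control \<rho> n (dyadic_index n x))) \<partial>unit_measure) =
      (SUP n. \<integral>\<^sup>+ x. ennreal (control \<rho> n (dyadic_index n x)) \<partial>unit_measure)"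
    by (rule nn_integral_monotone_convergence_SUP[OF inc step(1)])
  also have "\<dots> \<le> ennreal (1 / (1 - \<rho>)\<^sup>2 * ((2 * pm / (pm - 1)) powr pm * (2 powr pm * (2 * 2 powr pm))))"
    unfolding step(2) by (intro SUP_least ennreal_leI mean_control assms)
  finally show "(\<integral>\<^sup>+ x. (SUP n. ennreal (control \<rho> n (dyadic_index n x))) \<partial>unit_measure) \<le>
      ennreal (1 / (1 - \<rho>)\<^sup>2 * ((2 * pm / (pm - 1)) powr pm * (2 powr pm * (2 * 2 powr pm))))" .
qed

text \<open>The modular of \<open>V F\<close> divided by \<open>6 K / (1 - \<rho>)\<^sup>2\<close> is at most \<open>C\<close>. The additional factor
  \<open>max 1 C\<close> in \<open>\<Lambda>\<close> brings it below \<open>1\<close>, because \<open>p \<ge> 1\<close>.\<close>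

lemma V_maximal_modular:
  fixes \<alpha> s \<epsilon> :: real
  defines "\<rho> \<equiv> 2 powr (- (\<epsilon> / 2))"
  defines "C \<equiv> 1 / (1 - \<rho>)\<^sup>2 * ((2 * pm / (pm - 1)) powr pm * (2 powr pm * (2 * 2 powr pm)))"
  defines "\<Lambda> \<equiv> 6 * K / (1 - \<rho>)\<^sup>2 * max 1 C"
  assumes \<epsilon>: "0 < \<epsilon>" "\<epsilon> \<le> \<alpha>" "\<epsilon> \<le> \<alpha> + s - (1 / pm - 1 / pp)"
  shows "(\<integral>\<^sup>+ x. ennpowr (V_maximal \<alpha> s F x / ennreal \<Lambda>) (p x) \<partial>unit_measure) \<le> 1"
proof -
  let ?W = "\<lambda>x. SUP n. ennreal (control \<rho> n (dyadic_index n x))"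
  define C1 where "C1 = 6 * K / (1 - \<rho>)\<^sup>2"
  define M where "M = max 1 C"
  have \<rho>: "0 < \<rho>" "\<rho> < 1" using \<epsilon> powr_less_mono[of "- (\<epsilon> / 2)" 0 2] by (auto simp: \<rho>_def)
  have C1: "0 < C1" using K \<rho> by (simp add: C1_def)
  have M: "1 \<le> M" "C \<le> M" by (auto simp: M_def)
  have \<Lambda>_eq: "\<Lambda> = C1 * M" by (simp only: \<Lambda>_def C1_def M_def)
  then have \<Lambda>: "\<Lambda> = C1 * M" "0 < \<Lambda>" using C1 M by simp_all
  have pointwise: "ennpowr (V_maximal \<alpha> s F x / ennreal \<Lambda>) (p x) \<le> ennreal (1 / M) * ?W x"
    if x: "good x" "x \<in> {0..<1}" for x
  proof (cases "?W x = \<infinity>")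
    case True
    have "ennreal (1 / M) * ?W x = top"
      unfolding True using M by (simp add: ennreal_mult_top)
    then show ?thesis by (simp only: top_greatest)
  next
    case False
    then obtain w where w: "0 \<le> w" "?W x = ennreal w" by (cases "?W x") auto
    have px: "1 \<le> p x" using good_bounds[OF x(1)] pm by simp
    have "control \<rho> n (dyadic_index n x) \<le> w" for n
      using SUP_upper[of n UNIV "\<lambda>n. ennreal (control \<rho> n (dyadic_index n x))"] w by simp
    then have cw: "control \<rho> n (dyadic_index n x) powr (1 / p x) \<le> w powr (1 / p x)" for n
      using px \<rho> by (intro powr_mono2 control_nonneg) auto
    have "V_maximal \<alpha> s F x \<le> ennreal (C1 * w powr (1 / p x))"
      unfolding V_maximal_def
    proof (intro SUP_least, clarify, intro ennreal_leI)
      fix n k assume "x \<in> dyadic_interval n k"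
      then have k: "k = dyadic_index n x" using x by (simp add: mem_dyadic_interval_iff)
      show "(\<Sum>j = 0..<n. \<Sum>i = j..<n.
          2 powr ((real j - real n) * \<alpha>) * 2 powr ((real j - real i) * s) *
          (1 / measure unit_measure (shifted_interval (dyadic_interval n k) j i)) *
          \<bar>set_lebesgue_integral unit_measure (shifted_interval (dyadic_interval n k) j i) F\<bar>)
         \<le> C1 * w powr (1 / p x)"
        using V_sum_le[OF \<epsilon> x k] mult_left_mono[OF cw, of C1 n] C1
        by (simp only: \<rho>_def[symmetric] C1_def[symmetric] k) linarith
    qed
    then have "V_maximal \<alpha> s F x / ennreal \<Lambda> \<le> ennreal (C1 * w powr (1 / p x)) / ennreal \<Lambda>"
      by (rule divide_right_mono_ennreal)
    also have "\<dots> = ennreal (w powr (1 / p x) / M)"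
      using C1 M \<Lambda> by (simp add: divide_ennreal)
    finally have V: "V_maximal \<alpha> s F x / ennreal \<Lambda> \<le> ennreal (w powr (1 / p x) / M)" .
    then obtain v where v: "0 \<le> v" "V_maximal \<alpha> s F x / ennreal \<Lambda> = ennreal v"
      by (cases "V_maximal \<alpha> s F x / ennreal \<Lambda>") (auto simp: top_unique)
    have "v \<le> w powr (1 / p x) / M" using V M by (simp add: v ennreal_le_iff)
    then have "v powr p x \<le> (w powr (1 / p x) / M) powr p x"
      using v px by (intro powr_mono2) auto
    also have "\<dots> = w / M powr p x"
      using px w M by (simp add: powr_divide powr_powr)
    also have "\<dots> \<le> w / M powr 1"
      using M px w by (intro divide_left_mono powr_mono mult_pos_pos) auto
    finally have "v powr p x \<le> 1 / M * w" using M by simp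
    then show ?thesis using v w M by (simp add: ennpowr_def flip: ennreal_mult)
  qed
  have unit: "AE x in unit_measure. x \<in> {0..<1}" by (rule AE_I2) simp
  have "(\<integral>\<^sup>+ x. ennpowr (V_maximal \<alpha> s F x / ennreal \<Lambda>) (p x) \<partial>unit_measure) \<le>
      (\<integral>\<^sup>+ x. ennreal (1 / M) * ?W x \<partial>unit_measure)"
    by (rule nn_integral_mono_AE) (use good_AE unit in eventually_elim, use pointwise in blast)
  also have "\<dots> = ennreal (1 / M) * (\<integral>\<^sup>+ x. ?W x \<partial>unit_measure)"
    using \<rho> by (intro nn_integral_cmult nn_integral_control(1)) auto
  also have "\<dots> \<le> ennreal (1 / M) * ennreal C"
    unfolding C_def using \<rho> by (intro mult_left_mono nn_integral_control(2)) auto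
  also have "\<dots> \<le> ennreal (1 / M) * ennreal M"
    using M by (intro mult_left_mono ennreal_leI) auto
  also have "\<dots> = 1" using M by (simp flip: ennreal_mult)
  finally show ?thesis .
qed

end

lemma V_maximal_scale:
  assumes "0 < t"
  shows "V_maximal \<alpha> s f x = ennreal t * V_maximal \<alpha> s (\<lambda>x. f x / t) x"
proof -
  have "\<bar>set_lebesgue_integral unit_measure A f\<bar> = t * \<bar>set_lebesgue_integral unit_measure A (\<lambda>x. f x / t)\<bar>" for A
    using assms by (simp add: set_lebesgue_integral_def)
  then have *: "c * \<bar>set_lebesgue_integral unit_measure A f\<bar> = t * (c * \<bar>set_lebesgue_integral unit_measure A (\<lambda>x. f x / t)\<bar>)" for A c
    by (simp only: mult.left_commute[of c t])
  show ?thesis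
    unfolding V_maximal_def SUP_mult_left_ennreal *
    using assms by (intro SUP_cong refl, clarify)
      (simp only: sum_distrib_left[symmetric] ennreal_mult' less_imp_le)
qed

theorem theorem5p13:
  fixes p :: "real \<Rightarrow> real" and \<alpha> s K :: real
  assumes "p \<in> borel_measurable unit_measure"
    and "\<And>x. x \<in> {0..<1} \<Longrightarrow> 0 < p x"
    and "1 < p_minus p {0..<1}"
    and "p_minus p {0..<1} \<le> p_plus p {0..<1}"
    and "p_plus p {0..<1} < \<infinity>"
    and "0 < \<alpha>" and "0 < s"
    and "1 \<le> K"
    and "\<And>n k. k < 2 ^ n \<Longrightarrow>
           measure unit_measure (dyadic_interval n k) powr
             (real_of_ereal (p_minus p (dyadic_interval n k)) -
              real_of_ereal (p_plus p (dyadic_interval n k))) \<le> K"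
    and "1 / real_of_ereal (p_minus p {0..<1}) - 1 / real_of_ereal (p_plus p {0..<1}) < \<alpha> + s"
  shows "\<exists>C::real. 0 < C \<and>
           (\<forall>f \<in> var_Lp p. var_norm_nn p (V_maximal \<alpha> s f) \<le> ennreal C * var_norm p f)"
proof -
  define pm where "pm = real_of_ereal (p_minus p {0..<1})"
  define pp where "pp = real_of_ereal (p_plus p {0..<1})"
  have pm: "1 < pm" "pm \<le> pp"
    using assms(3-5) by (cases "p_minus p {0..<1}"; cases "p_plus p {0..<1}"; auto simp: pm_def pp_def)+
  obtain good where good: "AE x in unit_measure. good x"
    "\<And>x. good x \<Longrightarrow> pm \<le> p x \<and> p x \<le> pp"
    "\<And>x t j. good x \<Longrightarrow> good t \<Longrightarrow> x \<in> {0..<1} \<Longrightarrow> t \<in> {0..<1} \<Longrightarrow>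
           dyadic_index j x = dyadic_index j t \<Longrightarrow> 2 powr (real j * (p x - p t)) \<le> K"
    using log_hoelder_good_set[OF assms(1,3,4,5,9)] unfolding pm_def pp_def by blast
  define \<epsilon> where "\<epsilon> = min \<alpha> (\<alpha> + s - (1 / pm - 1 / pp))"
  have \<epsilon>: "0 < \<epsilon>" "\<epsilon> \<le> \<alpha>" "\<epsilon> \<le> \<alpha> + s - (1 / pm - 1 / pp)"
    using assms(6,10) by (auto simp: \<epsilon>_def pm_def pp_def)
  define \<rho> where "\<rho> = 2 powr (- (\<epsilon> / 2))"
  define \<Lambda> where "\<Lambda> = 6 * K / (1 - \<rho>)\<^sup>2 *
    max 1 (1 / (1 - \<rho>)\<^sup>2 * ((2 * pm / (pm - 1)) powr pm * (2 powr pm * (2 * 2 powr pm))))"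
  have "\<rho> < 1" using \<epsilon> powr_less_mono[of "- (\<epsilon> / 2)" 0 2] by (auto simp: \<rho>_def)
  then have \<Lambda>: "0 < \<Lambda>" using assms(8) by (auto simp: \<Lambda>_def intro!: mult_pos_pos)
  have "var_norm_nn p (V_maximal \<alpha> s f) \<le> ennreal \<Lambda> * var_norm p f" if f: "f \<in> var_Lp p" for f
  proof -
    have fm: "f \<in> borel_measurable unit_measure" using f by (simp add: var_Lp_def)
    have "var_norm_nn p (V_maximal \<alpha> s f) \<le> ennreal \<Lambda> * ennreal t"
      if t: "0 < t" and mod: "(\<integral>\<^sup>+ x. ennpowr (ennreal \<bar>f x\<bar> / ennreal t) (p x) \<partial>unit_measure) \<le> 1" for t
    proof -
      let ?F = "\<lambda>x. f x / t"
      have "ennpowr (ennreal \<bar>f x\<bar> / ennreal t) (p x) = ennreal (\<bar>?F x\<bar> powr p x)" for x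
        using t by (simp add: ennpowr_def divide_ennreal)
      then have "(\<integral>\<^sup>+ x. ennreal (\<bar>?F x\<bar> powr p x) \<partial>unit_measure) \<le> 1" using mod by simp
      moreover have "?F \<in> borel_measurable unit_measure" using fm by measurable
      ultimately have "(\<integral>\<^sup>+ x. ennpowr (V_maximal \<alpha> s ?F x / ennreal \<Lambda>) (p x) \<partial>unit_measure) \<le> 1"
        unfolding \<Lambda>_def \<rho>_def
        using V_maximal_modular[OF assms(1) _ pm assms(8) good _ \<epsilon>] by blast
      moreover have "V_maximal \<alpha> s f x / ennreal (\<Lambda> * t) = V_maximal \<alpha> s ?F x / ennreal \<Lambda>" for x
      proof -
        have "V_maximal \<alpha> s f x / ennreal (\<Lambda> * t) = (V_maximal \<alpha> s ?F x * ennreal t) / (ennreal \<Lambda> * ennreal t)"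
          using t \<Lambda> by (simp add: V_maximal_scale[OF t, of \<alpha> s f] ennreal_mult mult.commute)
        also have "\<dots> = V_maximal \<alpha> s ?F x / ennreal \<Lambda>"
          using t by (intro divide_mult_eq) auto
        finally show ?thesis .
      qed
      ultimately have "(\<integral>\<^sup>+ x. ennpowr (V_maximal \<alpha> s f x / ennreal (\<Lambda> * t)) (p x) \<partial>unit_measure) \<le> 1"
        by simp
      then have "var_norm_nn p (V_maximal \<alpha> s f) \<le> ennreal (\<Lambda> * t)"
        unfolding var_norm_nn_def using t \<Lambda> by (intro Inf_lower) (auto intro!: exI[of _ "\<Lambda> * t"])
      then show ?thesis using t \<Lambda> by (simp add: ennreal_mult)
    qed
    then have "var_norm_nn p (V_maximal \<alpha> s f) / ennreal \<Lambda> \<le> var_norm p f"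
      unfolding var_norm_def var_norm_nn_def[of p "\<lambda>x. ennreal \<bar>f x\<bar>"] using \<Lambda>
      by (intro Inf_greatest) (auto intro!: divide_le_posI_ennreal simp: mult.commute)
    then have "ennreal \<Lambda> * (var_norm_nn p (V_maximal \<alpha> s f) / ennreal \<Lambda>) \<le> ennreal \<Lambda> * var_norm p f"
      by (rule mult_left_mono) simp
    moreover have "ennreal \<Lambda> * (X / ennreal \<Lambda>) = X" for X
      using \<Lambda> by (simp add: ennreal_times_divide mult.commute[of _ X] ennreal_mult_divide_eq)
    ultimately show ?thesis by simp
  qed
  then show ?thesis using \<Lambda> by blast
qed

end
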